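(* For $n\ge1$ let $N_m(n)$ be the total number of pairs $(A,M)$ where $A$ is a labeled tree on $\{1,\dots,n\}$ and $M$ is a maximum-cardinality matching of $A$. Let $F_m(x)=\sum_{n\ge1}\frac{N_m(n)}{n!}x^n$. Then, as formal power series, $$F_m(x)=-\tfrac12\big(xe^U+U\big)^2+\big(1+Uxe^U\big)xe^U+U-U^2,$$ where $U=U(x)$ is the formal power series with $U(0)=0$ satisfying $U=x^2\exp\!\big(-x^2e^{2U}+xe^U+3U\big)$. The first values ($n=1,\dots,10$) are $N_m=(1,1,6,24,320,3270,55482,999656,21718440,544829130)$.
   Context: A matching of a graph is a set of pairwise non-adjacent edges; maximum-cardinality means of largest possible size (the empty matching is the maximum matching of the one-vertex tree). *)

theory Defs
  imports "HOL-Computational_Algebra.Formal_Power_Series"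
begin

text \<open>Simple graphs on the vertex set {1..n}, given by a set of 2-element edges.\<close>

definition possible_edges :: "nat \<Rightarrow> nat set set" where
  "possible_edges n = {e. \<exists>a b. e = {a, b} \<and> a \<noteq> b \<and> a \<in> {1..n} \<and> b \<in> {1..n}}"

definition adj_rel :: "nat set set \<Rightarrow> (nat \<times> nat) set" where
  "adj_rel E = {(a, b). {a, b} \<in> E \<and> a \<noteq> b}"

text \<open>A labeled tree on {1..n}: a connected simple graph with n - 1 edges.\<close>
definition is_labeled_tree :: "nat \<Rightarrow> nat set set \<Rightarrow> bool" where
  "is_labeled_tree n E \<longleftrightarrow> E \<subseteq> possible_edges n \<and> card E = n - 1 \<and>
     (\<forall>u\<in>{1..n}. \<forall>v\<in>{1..n}. (u, v) \<in> (adj_rel E)\<^sup>*)"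

definition is_matching :: "nat set set \<Rightarrow> nat set set \<Rightarrow> bool" where
  "is_matching E M \<longleftrightarrow> M \<subseteq> E \<and> (\<forall>e\<in>M. \<forall>f\<in>M. e \<noteq> f \<longrightarrow> e \<inter> f = {})"

definition is_max_matching :: "nat set set \<Rightarrow> nat set set \<Rightarrow> bool" where
  "is_max_matching E M \<longleftrightarrow> is_matching E M \<and>
     (\<forall>M'. is_matching E M' \<longrightarrow> card M' \<le> card M)"

definition N_m :: "nat \<Rightarrow> nat" where
  "N_m n = card {(E, M). is_labeled_tree n E \<and> is_max_matching E M}"

definition F_m :: "real fps" where
  "F_m = Abs_fps (\<lambda>n. if n = 0 then 0 else real (N_m n) / fact n)"

text \<open>exp of a formal power series with zero constant term: composition with exp.\<close>
definition fexp :: "real fps \<Rightarrow> real fps" where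
  "fexp U = fps_compose (fps_exp 1) U"

end

(* Write a tree with a distinguished edge {a, b} as two trees rooted at a and b. How the maximum
   matchings behave under this splitting depends only on whether each root is covered by all
   maximum matchings of its part, and the numbers of maximum matchings of the whole tree, with or
   without the root, are bilinear in those of the parts. A tree on n vertices with root a has
   n - 1 vertices other than a, each below exactly one neighbour of a. Weighting the edges at the
   root by the size of the cut-off part therefore turns the bilinear rules into the differential
   system x W' - W = sum U_i (x V_i') for the exponential generating functions of rooted trees.
   The system has a unique solution, which is written down in terms of U. Finally x F_m'
   enumerates rooted trees, and this identifies F_m. *)
theory Submission
  imports Defs "HOL-Computational_Algebra.Polynomial"
begin

unbundle fps_syntax

section \<open>The functional equation\<close>

text \<open>The number of maximum matchings has no uniform product rule, because the parts decide
  which matchings are maximum. Matching polynomials do have one, and their leading coefficients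
  inherit the bilinear rules. Cutting one edge at the root, instead of taking the set of all
  branches, keeps each step a bijection between one tree and two. The solution has a combinatorial
  reading. Call a root essential if all maximum matchings cover it, and let U and B count maximum
  matchings with essential and inessential root. Let y count those that miss the root, so that all
  branches are essential: y = x e^U. Let z count the matchings that are maximum among those missing
  the root, with arbitrary branches: z = x e^(U+B). An essential root a is matched to some b;
  cutting ab leaves parts counted by z and y, so U = yz. An inessential root is missed (y) or
  matched into a branch with essential root (y(z - y)), so B = y + U - y^2. Then U = yz = x^2 exp(2U
  + B) is the functional equation. In \<open>ode_solution\<close> these series are checked against
  the differential system.\<close>

lemma fexp_nth_0 [simp]: "fexp U $ 0 = 1"
  by (simp add: fexp_def)

lemma fps_deriv_fexp:
  "U $ 0 = 0 \<Longrightarrow> fps_deriv (fexp U) = fexp U * fps_deriv U"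
  by (simp add: fexp_def fps_compose_deriv)

lemma fexp_uminus_mult:
  assumes "U $ 0 = 0"
  shows "fexp (- U) * fexp U = 1"
proof -
  have "fps_deriv (fexp (- U) * fexp U) = 0"
    using assms by (simp add: fps_deriv_fexp algebra_simps)
  then have "fexp (- U) * fexp U = fps_const ((fexp (- U) * fexp U) $ 0)"
    by (simp only: fps_deriv_eq_0_iff)
  then show ?thesis by simp
qed

text \<open>The product of \<open>fexp (- (U + V))\<close> with either side has derivative zero and
  is therefore 1. Real power series form an integral domain, so the common factor cancels.\<close>

lemma fexp_add:
  assumes U: "U $ 0 = 0" and V: "V $ 0 = 0"
  shows "fexp (U + V) = fexp U * fexp V"
proof -
  let ?q = "fexp (- (U + V)) * (fexp U * fexp V)"
  have "fps_deriv ?q = 0"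
    using assms by (simp add: fps_deriv_fexp algebra_simps)
  then have "?q = fps_const (?q $ 0)"
    by (simp only: fps_deriv_eq_0_iff)
  then have "?q = 1" by simp
  moreover have "fexp (- (U + V)) * fexp (U + V) = 1"
    using assms by (intro fexp_uminus_mult) simp
  ultimately have "fexp (- (U + V)) * fexp (U + V) = fexp (- (U + V)) * (fexp U * fexp V)"
    by simp
  moreover have "fexp (- (U + V)) \<noteq> 0"
    by (metis fexp_nth_0 fps_zero_nth zero_neq_one)
  ultimately show ?thesis by simp
qed

text \<open>An X-adic Lipschitz estimate in the form of a divisibility. With W = U - V the
  difference is \<open>fexp V * (fexp W - 1)\<close>, and exp(t) - 1 is t times a series.\<close>

lemma fexp_diff_dvd:
  assumes U: "U $ 0 = 0" and V: "V $ 0 = 0"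
  shows "U - V dvd fexp U - fexp V"
proof -
  define W where "W = U - V"
  have W: "W $ 0 = 0" using assms by (simp add: W_def)
  define g :: "real fps" where "g = fps_shift 1 (fps_exp 1 - 1)"
  have "(fps_exp 1 - 1 :: real fps) = fps_X * g"
    unfolding g_def by (rule fps_ext) (simp add: fps_X_mult_nth)
  then have "(fps_exp 1 - 1 :: real fps) oo W = W * (g oo W)"
    using W by (simp add: fps_compose_mult_distrib fps_X_fps_compose_startby0)
  then have "fexp W - 1 = W * (g oo W)"
    by (simp add: fexp_def fps_compose_sub_distrib)
  moreover have "fexp U = fexp V * fexp W"
    using fexp_add[OF V W] by (simp add: W_def)
  ultimately have "fexp U - fexp V = W * (fexp V * (g oo W))"
    by (simp add: algebra_simps)
  then show ?thesis unfolding W_def by simp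
qed

definition matching_step :: "real fps \<Rightarrow> real fps" where
  "matching_step U = fps_X ^ 2 * fexp (- (fps_X ^ 2 * fexp (2 * U)) + fps_X * fexp U + 3 * U)"

lemma matching_step_nth_0 [simp]: "matching_step U $ 0 = 0"
  by (simp add: matching_step_def)

text \<open>X-adic contraction: the exponent is Lipschitz in \<open>U\<close>, and the prefactor
  \<open>fps_X ^ 2\<close> gains two orders.\<close>

lemma matching_step_diff_dvd:
  assumes U: "U $ 0 = 0" and V: "V $ 0 = 0"
  shows "fps_X ^ 2 * (U - V) dvd matching_step U - matching_step V"
proof -
  let ?e = "\<lambda>U. - (fps_X ^ 2 * fexp (2 * U)) + fps_X * fexp U + 3 * U"
  have "2 * U - 2 * V dvd fexp (2 * U) - fexp (2 * V)"
    by (rule fexp_diff_dvd) (use assms in simp_all)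
  then have 2: "U - V dvd fexp (2 * U) - fexp (2 * V)"
    by (metis dvd_mult_right right_diff_distrib)
  have "U - V dvd - (fps_X ^ 2 * (fexp (2 * U) - fexp (2 * V)))
      + fps_X * (fexp U - fexp V) + 3 * (U - V)"
    by (intro dvd_add dvd_mult 2 fexp_diff_dvd[OF assms] dvd_refl iffD2[OF dvd_minus_iff])
  also have "\<dots> = ?e U - ?e V" by (simp add: algebra_simps)
  also have "\<dots> dvd fexp (?e U) - fexp (?e V)"
    by (rule fexp_diff_dvd) (use assms in simp_all)
  finally have "fps_X ^ 2 * (U - V) dvd fps_X ^ 2 * (fexp (?e U) - fexp (?e V))"
    by (intro mult_dvd_mono) auto
  then show ?thesis by (simp add: matching_step_def algebra_simps)
qed

lemma fps_eq_0_if_X_power_dvd: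
  fixes U :: "'a :: comm_ring_1 fps"
  assumes "\<And>k. fps_X ^ k dvd U"
  shows "U = 0"
proof (rule fps_ext)
  fix n
  from assms[of "Suc n"] obtain W where "U = fps_X ^ Suc n * W" by (elim dvdE)
  then show "U $ n = 0 $ n" by (simp only: fps_X_power_mult_nth) simp
qed

text \<open>Banach's fixed point argument in the X-adic metric. For uniqueness, the difference D of
  two fixed points satisfies D = x^2 D K, and 1 - x^2 K is nonzero because its constant term is
  1.\<close>

lemma ex1_matching_step_fixpoint: "\<exists>!U. U $ 0 = 0 \<and> U = matching_step U"
proof (rule ex_ex1I)
  define u where "u k = (matching_step ^^ k) 0" for k
  have u0: "u k $ 0 = 0" for k by (cases k) (simp_all add: u_def)
  have uS: "u (Suc k) = matching_step (u k)" for k by (simp add: u_def)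
  have d: "fps_X ^ Suc k dvd u (Suc k) - u k" for k
  proof (induction k)
    case 0
    show ?case by (simp add: u_def matching_step_def)
  next
    case (Suc k)
    have "fps_X ^ Suc (Suc k) dvd fps_X ^ 2 * (u (Suc k) - u k)"
    proof -
      have "(fps_X :: real fps) ^ Suc (Suc k) = fps_X * fps_X ^ Suc k"
        by (rule power_Suc)
      also have "\<dots> dvd fps_X ^ 2 * (u (Suc k) - u k)"
        by (intro mult_dvd_mono Suc) (simp add: power2_eq_square)
      finally show ?thesis .
    qed
    then show ?case
      using dvd_trans matching_step_diff_dvd[OF u0 u0, of "Suc k" k] unfolding uS by blast
  qed
  \<comment> \<open>Coefficient \<open>n\<close> is stable from the \<open>n\<close>-th iterate on,
    so the diagonal series defined below is the limit.\<close>
  have c: "u (n + j) $ n = u n $ n" for n j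
  proof (induction j)
    case (Suc j)
    obtain W where "u (Suc (n + j)) - u (n + j) = fps_X ^ Suc (n + j) * W"
      using d[of "n + j"] by (elim dvdE)
    then have "(u (Suc (n + j)) - u (n + j)) $ n = 0"
      by (simp only: fps_X_power_mult_nth) simp
    with Suc show ?case by simp
  qed simp
  define U where "U = Abs_fps (\<lambda>n. u n $ n)"
  have U0: "U $ 0 = 0" by (simp add: U_def u0)
  have Uu: "fps_X ^ k dvd U - u k" for k
  proof -
    have "(U - u k) $ n = 0" if "n < k" for n
      using c[of n "k - n"] that by (simp add: U_def)
    then have "U - u k = fps_X ^ k * fps_shift k (U - u k)"
      by (intro fps_ext) (auto simp: fps_X_power_mult_nth)
    then show ?thesis by (metis dvd_triv_left)
  qed
  have "fps_X ^ k dvd U - matching_step U" for k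
  proof -
    have "fps_X ^ k dvd matching_step U - matching_step (u k)"
      by (rule dvd_trans[OF dvd_mult[OF Uu] matching_step_diff_dvd[OF U0 u0]])
    moreover have "fps_X ^ k dvd U - u (Suc k)"
      by (rule dvd_trans[OF _ Uu]) (simp add: le_imp_power_dvd)
    ultimately have "fps_X ^ k dvd (U - u (Suc k)) - (matching_step U - matching_step (u k))"
      by (rule dvd_diff[rotated])
    then show ?thesis by (simp add: uS)
  qed
  then have "U - matching_step U = 0" by (rule fps_eq_0_if_X_power_dvd)
  then show "\<exists>U. U $ 0 = 0 \<and> U = matching_step U"
    using U0 by auto
next
  fix U V assume U: "U $ 0 = 0 \<and> U = matching_step U" and V: "V $ 0 = 0 \<and> V = matching_step V"
  then obtain K where "U - V = fps_X ^ 2 * (U - V) * K"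
    using matching_step_diff_dvd[of U V] by (metis dvdE)
  then have "(U - V) * (1 - fps_X ^ 2 * K) = 0" by (simp add: algebra_simps)
  moreover have "(1 - fps_X ^ 2 * K) $ 0 \<noteq> 0" by simp
  then have "1 - fps_X ^ 2 * K \<noteq> 0" by (metis fps_zero_nth)
  ultimately show "U = V" by simp
qed

section \<open>Splitting a tree at an edge\<close>

definition connected_on :: "nat set \<Rightarrow> nat set set \<Rightarrow> bool" where
  "connected_on S E \<longleftrightarrow> (\<forall>u\<in>S. \<forall>v\<in>S. (u, v) \<in> (adj_rel E)\<^sup>*)"

definition edges_on :: "nat set \<Rightarrow> nat set set" where
  "edges_on S = {{a, b} | a b. a \<noteq> b \<and> a \<in> S \<and> b \<in> S}"

text \<open>By truncated subtraction the empty set carries the empty tree. It has no root and so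
  adds nothing to sums over rooted trees.\<close>

definition tree_on :: "nat set \<Rightarrow> nat set set \<Rightarrow> bool" where
  "tree_on S E \<longleftrightarrow> E \<subseteq> edges_on S \<and> card E = card S - 1 \<and> connected_on S E"

lemma is_labeled_tree_iff: "is_labeled_tree n E \<longleftrightarrow> tree_on {1..n} E"
  by (simp add: is_labeled_tree_def tree_on_def connected_on_def edges_on_def possible_edges_def)

lemma edges_on_subset_Pow: "edges_on S \<subseteq> Pow S"
  by (auto simp: edges_on_def)

lemma finite_edges_on: "finite S \<Longrightarrow> finite (edges_on S)"
  by (rule finite_subset[OF edges_on_subset_Pow]) simp

lemma finite_edges: "finite S \<Longrightarrow> E \<subseteq> edges_on S \<Longrightarrow> finite E"
  using finite_edges_on finite_subset by blast

lemma edges_on_cases: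
  assumes "E \<subseteq> edges_on S" "e \<in> E"
  obtains x y where "e = {x, y}" "x \<noteq> y" "x \<in> S" "y \<in> S"
  using assms by (auto simp: edges_on_def)

lemma empty_notin_edges_on: "{} \<notin> edges_on S"
  by (auto simp: edges_on_def)

lemma edges_on_restrict: "E \<subseteq> edges_on S \<Longrightarrow> {e \<in> E. e \<subseteq> A} \<subseteq> edges_on A"
  unfolding edges_on_def by blast

lemma adj_rel_iff: "(a, b) \<in> adj_rel E \<longleftrightarrow> {a, b} \<in> E \<and> a \<noteq> b"
  by (simp add: adj_rel_def)

lemma adj_rel_sym: "(a, b) \<in> adj_rel E \<Longrightarrow> (b, a) \<in> adj_rel E"
  by (simp add: adj_rel_def insert_commute)

lemma adj_rel_mono: "E \<subseteq> E' \<Longrightarrow> adj_rel E \<subseteq> adj_rel E'"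
  by (auto simp: adj_rel_def)

lemma reach_mono: "E \<subseteq> E' \<Longrightarrow> (a, b) \<in> (adj_rel E)\<^sup>* \<Longrightarrow> (a, b) \<in> (adj_rel E')\<^sup>*"
  using rtrancl_mono[OF adj_rel_mono] by blast

lemma reach_sym: "(a, b) \<in> (adj_rel E)\<^sup>* \<Longrightarrow> (b, a) \<in> (adj_rel E)\<^sup>*"
  by (induction rule: rtrancl_induct) (auto intro: converse_rtrancl_into_rtrancl adj_rel_sym)

lemma reach_closed:
  assumes "(a, v) \<in> (adj_rel E)\<^sup>*" "a \<in> X"
    and "\<And>u v. u \<in> X \<Longrightarrow> (u, v) \<in> adj_rel E \<Longrightarrow> v \<in> X"
  shows "v \<in> X"
  using assms(1) by (induction rule: rtrancl_induct) (auto intro: assms)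

text \<open>Grow a vertex set from a single vertex: connectedness supplies an edge leaving any
  proper subset, so each new vertex brings a new edge. With trees defined by their edge count, this
  bound is what passes the tree property to the two parts after a cut.\<close>

lemma card_edges_ge:
  assumes fin: "finite S" and con: "connected_on S E" and "E \<subseteq> edges_on S"
  shows "card S - 1 \<le> card E"
proof (cases "S = {}")
  case False
  have finE: "finite E" using finite_edges assms by blast
  have "\<exists>X\<subseteq>S. card X = Suc k \<and> k \<le> card {e \<in> E. e \<subseteq> X}" if "Suc k \<le> card S" for k
    using that
  proof (induction k)
    case 0
    from False obtain a where "a \<in> S" by auto
    then show ?case by (intro exI[of _ "{a}"]) auto
  next
    case (Suc k)
    then obtain X where X: "X \<subseteq> S" "card X = Suc k" "k \<le> card {e \<in> E. e \<subseteq> X}" by auto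
    have finX: "finite X" using X fin finite_subset by blast
    from X(2) obtain a where a: "a \<in> X" by (metis card.empty equals0I nat.distinct(1))
    have "X \<noteq> S" using X Suc by auto
    then obtain b where b: "b \<in> S" "b \<notin> X" using X by auto
    have "(a, b) \<in> (adj_rel E)\<^sup>*" using con a b X by (auto simp: connected_on_def)
    then obtain u v where uv: "u \<in> X" "(u, v) \<in> adj_rel E" "v \<notin> X"
      using reach_closed[of a b E X] a b by blast
    then have "{u, v} \<in> E" by (simp add: adj_rel_iff)
    then have "v \<in> S" using assms edges_on_subset_Pow by blast
    have "insert {u, v} {e \<in> E. e \<subseteq> X} \<subseteq> {e \<in> E. e \<subseteq> insert v X}"
      using uv \<open>{u, v} \<in> E\<close> by auto
    then have "card (insert {u, v} {e \<in> E. e \<subseteq> X}) \<le> card {e \<in> E. e \<subseteq> insert v X}"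
      using finE by (intro card_mono) auto
    moreover have "card (insert {u, v} {e \<in> E. e \<subseteq> X}) = Suc (card {e \<in> E. e \<subseteq> X})"
      using finE uv by (subst card_insert_disjoint) auto
    ultimately show ?case
      using X uv finX \<open>v \<in> S\<close> by (intro exI[of _ "insert v X"]) auto
  qed
  moreover have "card S \<noteq> 0" using False fin by simp
  ultimately obtain X where "card S - 1 \<le> card {e \<in> E. e \<subseteq> X}"
    by (metis One_nat_def Suc_pred neq0_conv order_refl)
  also have "\<dots> \<le> card E" using finE by (intro card_mono) auto
  finally show ?thesis .
qed simp

text \<open>The component of \<open>b\<close> once the edge to \<open>a\<close> is deleted; in a
  tree rooted at \<open>a\<close> it is the branch at \<open>b\<close>. Swapping the arguments gives
  the other end.\<close>

definition side :: "nat set set \<Rightarrow> nat \<Rightarrow> nat \<Rightarrow> nat set" where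
  "side E a b = {v. (b, v) \<in> (adj_rel (E - {{a, b}}))\<^sup>*}"

lemma mem_side [simp]: "b \<in> side E a b"
  by (simp add: side_def)

lemma side_step:
  "u \<in> side E a b \<Longrightarrow> {u, v} \<in> E \<Longrightarrow> {u, v} \<noteq> {a, b} \<Longrightarrow> v \<in> side E a b"
  unfolding side_def using rtrancl_into_rtrancl[of b u "adj_rel (E - {{a, b}})" v]
  by (cases "u = v") (simp_all add: adj_rel_iff)

lemma side_connected: "connected_on (side E a b) {e \<in> E - {{a, b}}. e \<subseteq> side E a b}"
proof -
  let ?R = "adj_rel {e \<in> E - {{a, b}}. e \<subseteq> side E a b}"
  have *: "(b, v) \<in> ?R\<^sup>*" if "(b, v) \<in> (adj_rel (E - {{a, b}}))\<^sup>*" for v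
    using that
  proof (induction rule: rtrancl_induct)
    case (step u v)
    then have "u \<in> side E a b" by (simp add: side_def)
    moreover have "v \<in> side E a b"
      using step by (auto simp: side_def intro: rtrancl_into_rtrancl)
    ultimately have "(u, v) \<in> ?R" using step(2) by (auto simp: adj_rel_iff)
    with step show ?case by (auto intro: rtrancl_into_rtrancl)
  qed auto
  then show ?thesis
    unfolding connected_on_def
    by (metis (no_types, lifting) mem_Collect_eq reach_sym rtrancl_trans side_def)
qed

text \<open>If the sides met, \<open>E\<close> without the edge would connect \<open>S\<close> with
  \<open>card S - 2\<close> edges, against \<open>card_edges_ge\<close>. Once they are disjoint, the
  parts have \<open>card A + card B - 2\<close> edges in total and each at least its lower bound, so
  both bounds are attained.\<close>

lemma side_split:
  assumes fin: "finite S" and T: "tree_on S E" and ab: "(a, b) \<in> adj_rel E"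
  defines "A \<equiv> side E b a" and "B \<equiv> side E a b"
  shows "A \<union> B = S" "A \<inter> B = {}"
    "tree_on A {e \<in> E. e \<subseteq> A}" "tree_on B {e \<in> E. e \<subseteq> B}"
    "E = insert {a, b} ({e \<in> E. e \<subseteq> A} \<union> {e \<in> E. e \<subseteq> B})"
proof -
  let ?E = "E - {{a, b}}"
  have sub: "E \<subseteq> edges_on S" and con: "connected_on S E" and cE: "card E = card S - 1"
    using T by (auto simp: tree_on_def)
  have finE: "finite E" using finite_edges fin sub by blast
  have eab: "{a, b} \<in> E" "a \<noteq> b" using ab by (auto simp: adj_rel_iff)
  then have abS: "a \<in> S" "b \<in> S" using sub edges_on_subset_Pow by blast+
  have Adef: "A = {v. (a, v) \<in> (adj_rel ?E)\<^sup>*}"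
    by (simp add: A_def side_def insert_commute)
  have Bdef: "B = {v. (b, v) \<in> (adj_rel ?E)\<^sup>*}"
    by (simp add: B_def side_def)
  have stepS: "v \<in> S" if "(u, v) \<in> adj_rel E" for u v
    using that sub edges_on_subset_Pow by (fastforce simp: adj_rel_iff)
  have stepA: "v \<in> A" if "u \<in> A" "(u, v) \<in> adj_rel ?E" for u v
    using that by (auto simp: Adef intro: rtrancl_into_rtrancl)
  have stepB: "v \<in> B" if "u \<in> B" "(u, v) \<in> adj_rel ?E" for u v
    using that by (auto simp: Bdef intro: rtrancl_into_rtrancl)
  have aA: "a \<in> A" and bB: "b \<in> B" by (auto simp: Adef Bdef)
  show AB: "A \<union> B = S"
  proof
    have "v \<in> S" if "w \<in> S" "(w, v) \<in> (adj_rel ?E)\<^sup>*" for v w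
      using reach_closed[OF that(2,1)] stepS adj_rel_mono[of ?E E] by blast
    then show "A \<union> B \<subseteq> S" using abS by (auto simp: Adef Bdef)
    show "S \<subseteq> A \<union> B"
    proof
      fix v assume "v \<in> S"
      then have "(a, v) \<in> (adj_rel E)\<^sup>*" using con abS by (auto simp: connected_on_def)
      moreover have "y \<in> A \<union> B" if "x \<in> A \<union> B" "(x, y) \<in> adj_rel E" for x y
      proof (cases "{x, y} = {a, b}")
        case True
        then show ?thesis using aA bB by (auto simp: doubleton_eq_iff)
      next
        case False
        then have "(x, y) \<in> adj_rel ?E" using that by (simp add: adj_rel_iff)
        then show ?thesis using that(1) stepA stepB by blast
      qed
      ultimately show "v \<in> A \<union> B" using reach_closed[of a v E "A \<union> B"] aA by blast
    qed
  qed
  have cE': "card ?E = card S - 2" using eab finE cE by simp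
  have S2: "card S \<ge> 2"
    using card_mono[of S "{a, b}"] fin abS eab by simp
  show disj: "A \<inter> B = {}"
  proof (rule ccontr)
    assume "A \<inter> B \<noteq> {}"
    then obtain w where "(a, w) \<in> (adj_rel ?E)\<^sup>*" "(b, w) \<in> (adj_rel ?E)\<^sup>*"
      by (auto simp: Adef Bdef)
    then have "(a, b) \<in> (adj_rel ?E)\<^sup>*" using reach_sym rtrancl_trans by metis
    then have "(a, v) \<in> (adj_rel ?E)\<^sup>*" if "v \<in> S" for v
      using that AB by (auto simp: Adef Bdef intro: rtrancl_trans)
    then have "connected_on S ?E"
      unfolding connected_on_def using reach_sym rtrancl_trans by metis
    then have "card S - 1 \<le> card ?E"
      using sub fin by (intro card_edges_ge) auto
    then show False using cE' S2 by simp
  qed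
  have EA: "{e \<in> ?E. e \<subseteq> A} = {e \<in> E. e \<subseteq> A}" using bB disj by auto
  have EB: "{e \<in> ?E. e \<subseteq> B} = {e \<in> E. e \<subseteq> B}" using aA disj by auto
  have conA: "connected_on A {e \<in> E. e \<subseteq> A}"
    using side_connected[of E b a] EA by (simp add: A_def insert_commute)
  have conB: "connected_on B {e \<in> E. e \<subseteq> B}"
    using side_connected[of E a b] EB by (simp add: B_def)
  have subA: "{e \<in> E. e \<subseteq> A} \<subseteq> edges_on A" and subB: "{e \<in> E. e \<subseteq> B} \<subseteq> edges_on B"
    using edges_on_restrict[OF sub] by blast+
  show Eeq: "E = insert {a, b} ({e \<in> E. e \<subseteq> A} \<union> {e \<in> E. e \<subseteq> B})"
  proof
    show "E \<subseteq> insert {a, b} ({e \<in> E. e \<subseteq> A} \<union> {e \<in> E. e \<subseteq> B})"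
    proof
      fix e assume e: "e \<in> E"
      then obtain x y where xy: "e = {x, y}" "x \<noteq> y" "x \<in> S"
        using sub by (auto simp: edges_on_def)
      show "e \<in> insert {a, b} ({e \<in> E. e \<subseteq> A} \<union> {e \<in> E. e \<subseteq> B})"
      proof (cases "e = {a, b}")
        case False
        then have "(x, y) \<in> adj_rel ?E" using e xy by (auto simp: adj_rel_iff)
        then have "e \<subseteq> A \<or> e \<subseteq> B" using xy AB stepA stepB by blast
        then show ?thesis using e by auto
      qed simp
    qed
  qed (use eab in auto)
  have finAB: "finite A" "finite B" using fin AB by auto
  have "card ?E = card ({e \<in> E. e \<subseteq> A} \<union> {e \<in> E. e \<subseteq> B})"
  proof -
    have "{a, b} \<notin> {e \<in> E. e \<subseteq> A} \<union> {e \<in> E. e \<subseteq> B}" using aA bB disj by auto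
    then have "?E = {e \<in> E. e \<subseteq> A} \<union> {e \<in> E. e \<subseteq> B}" using Eeq by blast
    then show ?thesis by simp
  qed
  also have "\<dots> = card {e \<in> E. e \<subseteq> A} + card {e \<in> E. e \<subseteq> B}"
  proof (rule card_Un_disjoint)
    show "{e \<in> E. e \<subseteq> A} \<inter> {e \<in> E. e \<subseteq> B} = {}"
    proof (rule equals0I)
      fix e assume "e \<in> {e \<in> E. e \<subseteq> A} \<inter> {e \<in> E. e \<subseteq> B}"
      then have "e \<subseteq> A \<inter> B" "e \<in> E" by auto
      then show False using disj sub empty_notin_edges_on by auto
    qed
  qed (use finE in auto)
  finally have sum: "card ?E = card {e \<in> E. e \<subseteq> A} + card {e \<in> E. e \<subseteq> B}" .
  have "card S = card A + card B"
    using card_Un_disjoint[OF finAB disj] by (simp only: AB)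
  with sum cE' have "card {e \<in> E. e \<subseteq> A} + card {e \<in> E. e \<subseteq> B} = card A + card B - 2"
    by linarith
  moreover have "card A - 1 \<le> card {e \<in> E. e \<subseteq> A}" "card B - 1 \<le> card {e \<in> E. e \<subseteq> B}"
    using card_edges_ge[OF finAB(1) conA subA] card_edges_ge[OF finAB(2) conB subB] by simp_all
  moreover have "card A > 0" "card B > 0" using finAB aA bB card_gt_0_iff by blast+
  ultimately have "card {e \<in> E. e \<subseteq> A} = card A - 1" "card {e \<in> E. e \<subseteq> B} = card B - 1"
    by linarith+
  then show "tree_on A {e \<in> E. e \<subseteq> A}" "tree_on B {e \<in> E. e \<subseteq> B}"
    using conA conB subA subB by (auto simp: tree_on_def)
qed

abbreviation join :: "nat set set \<Rightarrow> nat \<Rightarrow> nat set set \<Rightarrow> nat \<Rightarrow> nat set set" where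
  "join E a F b \<equiv> insert {a, b} (E \<union> F)"

text \<open>Converse of \<open>side_split\<close>. The last three claims recover \<open>B\<close>,
  \<open>E\<close> and \<open>F\<close> from the joined tree, which makes cutting and joining
  inverse to each other in \<open>sum_edge_split\<close>.\<close>

lemma tree_on_join:
  assumes fin: "finite A" "finite B" and disj: "A \<inter> B = {}"
    and TA: "tree_on A E" and TB: "tree_on B F" and a: "a \<in> A" and b: "b \<in> B"
  shows "tree_on (A \<union> B) (join E a F b)"
    and "side (join E a F b) a b = B"
    and "{e \<in> join E a F b. e \<subseteq> A} = E"
    and "{e \<in> join E a F b. e \<subseteq> B} = F"
proof -
  have sub: "E \<subseteq> edges_on A" "F \<subseteq> edges_on B" using TA TB by (auto simp: tree_on_def)
  have con: "connected_on A E" "connected_on B F" using TA TB by (auto simp: tree_on_def)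
  have finE: "finite E" "finite F" using finite_edges fin sub by blast+
  have ne: "a \<noteq> b" "b \<notin> A" "a \<notin> B" using a b disj by auto
  have EA: "e \<subseteq> A \<and> \<not> e \<subseteq> B" if "e \<in> E" for e
    using edges_on_cases[OF sub(1) that] disj by auto
  have FB: "e \<subseteq> B \<and> \<not> e \<subseteq> A" if "e \<in> F" for e
    using edges_on_cases[OF sub(2) that] disj by auto
  show "{e \<in> join E a F b. e \<subseteq> A} = E" "{e \<in> join E a F b. e \<subseteq> B} = F"
    using EA FB ne by auto
  have nab: "{a, b} \<notin> E \<union> F" using EA FB ne by auto
  let ?R = "adj_rel (join E a F b)"
  have rA: "(u, v) \<in> ?R\<^sup>*" if "u \<in> A" "v \<in> A" for u v
    using con that reach_mono[of E "join E a F b" u v] by (auto simp: connected_on_def)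
  have rB: "(u, v) \<in> ?R\<^sup>*" if "u \<in> B" "v \<in> B" for u v
    using con that reach_mono[of F "join E a F b" u v] by (auto simp: connected_on_def)
  have "(a, b) \<in> ?R" using ne by (simp add: adj_rel_iff)
  then have ra: "(a, v) \<in> ?R\<^sup>*" if "v \<in> A \<union> B" for v
    using that rA[OF a] rB[OF b] by (auto intro: converse_rtrancl_into_rtrancl)
  then have "connected_on (A \<union> B) (join E a F b)"
    unfolding connected_on_def using reach_sym rtrancl_trans by metis
  moreover have "join E a F b \<subseteq> edges_on (A \<union> B)"
    using sub a b ne by (fastforce simp: edges_on_def)
  moreover have "card (join E a F b) = card (A \<union> B) - 1"
  proof -
    have "E \<inter> F = {}" using EA FB by auto
    then have "card (join E a F b) = Suc (card E + card F)"
      using finE nab by (simp add: card_Un_disjoint)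
    moreover have "card A > 0" "card B > 0" using fin a b card_gt_0_iff by blast+
    moreover have "card E = card A - 1" "card F = card B - 1"
      using TA TB by (simp_all add: tree_on_def)
    ultimately show ?thesis
      using card_Un_disjoint[OF fin disj] by linarith
  qed
  ultimately show "tree_on (A \<union> B) (join E a F b)" by (simp add: tree_on_def)
  have del: "join E a F b - {{a, b}} = E \<union> F" using nab by auto
  have "side (join E a F b) a b = {v. (b, v) \<in> (adj_rel (E \<union> F))\<^sup>*}"
    by (simp only: side_def del)
  also have "\<dots> = B"
  proof
    have "v \<in> B" if "u \<in> B" "(u, v) \<in> adj_rel (E \<union> F)" for u v
      using that EA FB disj by (fastforce simp: adj_rel_iff)
    then show "{v. (b, v) \<in> (adj_rel (E \<union> F))\<^sup>*} \<subseteq> B"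
      using reach_closed[of b _ "E \<union> F" B] b by blast
    show "B \<subseteq> {v. (b, v) \<in> (adj_rel (E \<union> F))\<^sup>*}"
      using con(2) b reach_mono[of F "E \<union> F"] by (auto simp: connected_on_def)
  qed
  finally show "side (join E a F b) a b = B" .
qed

lemma finite_trees: "finite S \<Longrightarrow> finite {E. tree_on S E}"
  by (rule finite_subset[of _ "Pow (edges_on S)"]) (auto simp: tree_on_def finite_edges_on)

lemma finite_adj:
  assumes "finite S" "tree_on S E"
  shows "finite {b. (a, b) \<in> adj_rel E}"
proof (rule finite_subset[OF _ assms(1)])
  show "{b. (a, b) \<in> adj_rel E} \<subseteq> S"
    using assms(2) edges_on_subset_Pow by (fastforce simp: adj_rel_iff tree_on_def)
qed

text \<open>Every vertex other than \<open>a\<close> lies in exactly one branch at \<open>a\<close>.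
  The total does not depend on the tree, so it can be pulled out of a sum over trees.\<close>

lemma sum_card_side:
  assumes fin: "finite S" and T: "tree_on S E" and a: "a \<in> S"
  shows "(\<Sum>b | (a, b) \<in> adj_rel E. card (side E a b)) = card S - 1"
proof -
  let ?N = "{b. (a, b) \<in> adj_rel E}"
  \<comment> \<open>The branch at \<open>b\<close> is connected and does not contain
    \<open>a\<close>, so it stays within the component of \<open>a\<close> after deleting the edge
    to \<open>c\<close>. That component is disjoint from the branch at \<open>c\<close>.\<close>
  have disj: "side E a b \<inter> side E a c = {}"
    if b: "(a, b) \<in> adj_rel E" and c: "(a, c) \<in> adj_rel E" and "b \<noteq> c" for b c
  proof -
    note sb = side_split[OF fin T b] and sc = side_split[OF fin T c]
    have "a \<notin> side E a b" using sb(2) mem_side[of a E b] by blast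
    have ne: "{a, b} \<noteq> {a, c}" using that by (auto simp: doubleton_eq_iff)
    have "b \<in> side E c a"
      using side_step[of a E c a b] b ne by (simp add: adj_rel_iff insert_commute)
    moreover have "v \<in> side E c a"
      if "u \<in> side E c a" "(u, v) \<in> adj_rel {e \<in> E. e \<subseteq> side E a b}" for u v
    proof -
      have "{u, v} \<in> E" "{u, v} \<subseteq> side E a b" using that by (auto simp: adj_rel_iff)
      moreover have "{u, v} \<noteq> {c, a}"
        using \<open>{u, v} \<subseteq> side E a b\<close> \<open>a \<notin> side E a b\<close> by auto
      ultimately show ?thesis using side_step that by blast
    qed
    ultimately have "w \<in> side E c a" if "w \<in> side E a b" for w
      using reach_closed[of b w "{e \<in> E. e \<subseteq> side E a b}" "side E c a"] sb(4) that
      by (auto simp: tree_on_def connected_on_def)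
    then show ?thesis using sc(2) by auto
  qed
  have union: "(\<Union>b\<in>?N. side E a b) = S - {a}"
  proof
    show "(\<Union>b\<in>?N. side E a b) \<subseteq> S - {a}"
    proof
      fix v assume "v \<in> (\<Union>b\<in>?N. side E a b)"
      then obtain b where b: "(a, b) \<in> adj_rel E" "v \<in> side E a b" by auto
      then show "v \<in> S - {a}"
        using side_split(1,2)[OF fin T b(1)] mem_side[of a E b] by blast
    qed
    show "S - {a} \<subseteq> (\<Union>b\<in>?N. side E a b)"
    proof
      fix v assume v: "v \<in> S - {a}"
      have "(a, v) \<in> (adj_rel E)\<^sup>*" using T a v by (auto simp: tree_on_def connected_on_def)
      moreover have "y \<in> insert a (\<Union>b\<in>?N. side E a b)"
        if x: "x \<in> insert a (\<Union>b\<in>?N. side E a b)" and xy: "(x, y) \<in> adj_rel E" for x y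
      proof (cases "x = a \<or> y = a")
        case True
        then show ?thesis using xy by auto
      next
        case False
        then obtain b where b: "b \<in> ?N" "x \<in> side E a b" using x by auto
        moreover have "{x, y} \<noteq> {a, b}" using False by (auto simp: doubleton_eq_iff)
        ultimately have "y \<in> side E a b" using xy side_step[of x E a b y] by (simp add: adj_rel_iff)
        then show ?thesis using b by auto
      qed
      ultimately have "v \<in> insert a (\<Union>b\<in>?N. side E a b)"
        using reach_closed[of a v E "insert a (\<Union>b\<in>?N. side E a b)"] by blast
      then show "v \<in> (\<Union>b\<in>?N. side E a b)" using v by auto
    qed
  qed
  have "finite (side E a b)" if "b \<in> ?N" for b
    using side_split(1)[OF fin T, of a b] that fin by (metis finite_Un mem_Collect_eq)
  then have "card (\<Union>b\<in>?N. side E a b) = (\<Sum>b\<in>?N. card (side E a b))"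
    using finite_adj[OF fin T] disj by (intro card_UN_disjoint) auto
  then show ?thesis using union a fin by simp
qed

text \<open>A tree with an oriented edge is the same as a subset \<open>B\<close> with rooted trees
  on \<open>B\<close> and on its complement. The subsets \<open>{}\<close> and \<open>S\<close> may
  stay in the sum, since a part without vertices offers no root.\<close>

lemma sum_edge_split:
  fixes f :: "nat set set \<Rightarrow> nat \<Rightarrow> nat \<Rightarrow> 'b :: comm_monoid_add"
  assumes fin: "finite S"
  shows "(\<Sum>E | tree_on S E. \<Sum>a\<in>S. \<Sum>b | (a, b) \<in> adj_rel E. f E a b) =
    (\<Sum>B\<in>Pow S. \<Sum>E | tree_on (S - B) E. \<Sum>a\<in>S - B. \<Sum>F | tree_on B F. \<Sum>b\<in>B.
      f (join E a F b) a b)"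
proof -
  let ?L = "SIGMA E:{E. tree_on S E}. SIGMA a:S. {b. (a, b) \<in> adj_rel E}"
  let ?R = "SIGMA B:Pow S. SIGMA E:{E. tree_on (S - B) E}. SIGMA a:S - B.
    SIGMA F:{F. tree_on B F}. B"
  have "(\<Sum>E | tree_on S E. \<Sum>a\<in>S. \<Sum>b | (a, b) \<in> adj_rel E. f E a b) =
      (\<Sum>(E, a, b)\<in>?L. f E a b)"
    using fin by (simp add: sum.Sigma finite_trees finite_adj finite_SigmaI split_def)
  also have "\<dots> = (\<Sum>(B, E, a, F, b)\<in>?R. f (join E a F b) a b)"
  proof (rule sum.reindex_bij_witness[where
        i = "\<lambda>(B, E, a, F, b). (join E a F b, a, b)" and
        j = "\<lambda>(E, a, b). (side E a b, {e \<in> E. e \<subseteq> side E b a}, a,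
              {e \<in> E. e \<subseteq> side E a b}, b)"])
    fix p assume "p \<in> ?L"
    then obtain E a b where p: "p = (E, a, b)" "tree_on S E" "(a, b) \<in> adj_rel E"
      by auto
    note s = side_split[OF fin p(2,3)]
    have "S - side E a b = side E b a" using s by auto
    then show "(case case p of (E, a, b) \<Rightarrow> (side E a b, {e \<in> E. e \<subseteq> side E b a}, a,
              {e \<in> E. e \<subseteq> side E a b}, b) of (B, E, a, F, b) \<Rightarrow> (join E a F b, a, b)) = p"
      "(case p of (E, a, b) \<Rightarrow> (side E a b, {e \<in> E. e \<subseteq> side E b a}, a,
              {e \<in> E. e \<subseteq> side E a b}, b)) \<in> ?R"
      "(case case p of (E, a, b) \<Rightarrow> (side E a b, {e \<in> E. e \<subseteq> side E b a}, a,
              {e \<in> E. e \<subseteq> side E a b}, b) of (B, E, a, F, b) \<Rightarrow> f (join E a F b) a b) =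
        (case p of (E, a, b) \<Rightarrow> f E a b)"
      using s p by auto
  next
    fix q assume "q \<in> ?R"
    then obtain B E a F b where q: "q = (B, E, a, F, b)" "B \<subseteq> S" "tree_on (S - B) E"
      "a \<in> S - B" "tree_on B F" "b \<in> B" by auto
    then have finB: "finite (S - B)" "finite B" "(S - B) \<inter> B = {}"
      using fin finite_subset by auto
    note t = tree_on_join[OF finB q(3,5,4,6)]
    have ab: "(a, b) \<in> adj_rel (join E a F b)" using q by (auto simp: adj_rel_iff)
    have S: "S - B \<union> B = S" using q by auto
    note s = side_split[OF fin t(1)[unfolded S] ab]
    have "side (join E a F b) b a = S - B" using s t(2) by auto
    then show "(case case q of (B, E, a, F, b) \<Rightarrow> (join E a F b, a, b) of (E, a, b) \<Rightarrow>
         (side E a b, {e \<in> E. e \<subseteq> side E b a}, a, {e \<in> E. e \<subseteq> side E a b}, b)) = q"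
      "(case q of (B, E, a, F, b) \<Rightarrow> (join E a F b, a, b)) \<in> ?L"
      using q t S ab by auto
  qed
  also have "\<dots> = (\<Sum>B\<in>Pow S. \<Sum>E | tree_on (S - B) E. \<Sum>a\<in>S - B. \<Sum>F | tree_on B F. \<Sum>b\<in>B.
      f (join E a F b) a b)"
  proof -
    have "finite B" if "B \<subseteq> S" for B using that fin finite_subset by blast
    then show ?thesis
      using fin by (simp add: sum.Sigma finite_trees finite_SigmaI split_def)
  qed
  finally show ?thesis .
qed

section \<open>Matching polynomials\<close>

definition matchings :: "nat set set \<Rightarrow> nat set set set" where
  "matchings E = {M. is_matching E M}"

definition matchings_avoiding :: "nat set set \<Rightarrow> nat \<Rightarrow> nat set set set" where
  "matchings_avoiding E a = {M \<in> matchings E. a \<notin> \<Union>M}"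

text \<open>The leading coefficient of the matching polynomial counts the maximum matchings. Unlike that
  number, the polynomial itself behaves under joining two trees without case distinctions.\<close>

definition card_poly :: "'a set set \<Rightarrow> nat poly" where
  "card_poly \<M> = (\<Sum>M\<in>\<M>. monom 1 (card M))"

abbreviation matching_poly :: "nat set set \<Rightarrow> nat poly" where
  "matching_poly E \<equiv> card_poly (matchings E)"

abbreviation matching_poly_avoiding :: "nat set set \<Rightarrow> nat \<Rightarrow> nat poly" where
  "matching_poly_avoiding E a \<equiv> card_poly (matchings_avoiding E a)"

lemma matchings_iff:
  "M \<in> matchings E \<longleftrightarrow> M \<subseteq> E \<and> (\<forall>e\<in>M. \<forall>f\<in>M. e \<noteq> f \<longrightarrow> e \<inter> f = {})"
  by (simp add: matchings_def is_matching_def)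

lemma matchings_avoiding_iff:
  "M \<in> matchings_avoiding E a \<longleftrightarrow> M \<in> matchings E \<and> (\<forall>e\<in>M. a \<notin> e)"
  by (auto simp: matchings_avoiding_def)

lemma finite_matchings: "finite E \<Longrightarrow> finite (matchings E)"
  by (rule finite_subset[of _ "Pow E"]) (auto simp: matchings_def is_matching_def)

lemma finite_matchings_avoiding: "finite E \<Longrightarrow> finite (matchings_avoiding E a)"
  by (simp add: matchings_avoiding_def finite_matchings)

lemma empty_matching: "{} \<in> matchings E" "{} \<in> matchings_avoiding E a"
  by (auto simp: matchings_def matchings_avoiding_def is_matching_def)

lemma coeff_card_poly:
  assumes "finite \<M>"
  shows "coeff (card_poly \<M>) k = card {M \<in> \<M>. card M = k}"
proof -
  have "coeff (card_poly \<M>) k = (\<Sum>M\<in>\<M>. if card M = k then 1 else 0)"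
    by (simp add: card_poly_def coeff_sum del: One_nat_def)
  also have "\<dots> = card {M \<in> \<M>. card M = k}"
    using assms by (simp add: sum.If_cases Int_def)
  finally show ?thesis .
qed

lemma degree_card_poly:
  assumes "finite \<M>" "\<M> \<noteq> {}"
  shows "degree (card_poly \<M>) = Max (card ` \<M>)" and "card_poly \<M> \<noteq> 0"
proof -
  let ?m = "Max (card ` \<M>)"
  have "?m \<in> card ` \<M>" using assms by (intro Max_in) auto
  then obtain N where "N \<in> \<M>" "card N = ?m" by auto
  then have "{M \<in> \<M>. card M = ?m} \<noteq> {}" by blast
  then have c: "coeff (card_poly \<M>) ?m \<noteq> 0"
    using assms by (simp only: coeff_card_poly) simp
  then show "card_poly \<M> \<noteq> 0" by (metis coeff_0)
  have "coeff (card_poly \<M>) k = 0" if "k > ?m" for k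
  proof -
    have "{M \<in> \<M>. card M = k} = {}"
      using that assms Max_ge[of "card ` \<M>"] by force
    then show ?thesis using assms by (simp only: coeff_card_poly card.empty)
  qed
  then have "degree (card_poly \<M>) \<le> ?m" by (intro degree_le) auto
  then show "degree (card_poly \<M>) = ?m" using le_degree[OF c] by simp
qed

lemma card_max_matchings:
  assumes "finite E"
  shows "card {M. is_max_matching E M} = lead_coeff (matching_poly E)"
proof -
  have fin: "finite (matchings E)" and ne: "matchings E \<noteq> {}"
    using finite_matchings[OF assms] empty_matching(1)[of E] by blast+
  have "is_max_matching E M \<longleftrightarrow> M \<in> matchings E \<and> card M = Max (card ` matchings E)" for M
  proof -
    have "is_max_matching E M \<longleftrightarrow> M \<in> matchings E \<and> (\<forall>N\<in>matchings E. card N \<le> card M)"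
      by (simp add: is_max_matching_def matchings_def)
    also have "\<dots> \<longleftrightarrow> M \<in> matchings E \<and> Max (card ` matchings E) = card M"
      using Max_eq_iff[of "card ` matchings E" "card M"] fin ne by auto
    finally show ?thesis by auto
  qed
  then have "{M. is_max_matching E M} = {M \<in> matchings E. card M = Max (card ` matchings E)}"
    by simp
  then show ?thesis
    using fin ne by (simp add: degree_card_poly coeff_card_poly)
qed

text \<open>At most one edge of a matching contains \<open>a\<close>, and dropping it leaves a
  matching that misses \<open>a\<close>. The two degrees thus differ by 0 or 1; this bit will be the
  type of the root.\<close>

lemma degree_matching_poly:
  assumes "finite E"
  shows "matching_poly E \<noteq> 0" "matching_poly_avoiding E a \<noteq> 0"
    and "degree (matching_poly_avoiding E a) \<le> degree (matching_poly E)"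
    and "degree (matching_poly E) \<le> Suc (degree (matching_poly_avoiding E a))"
proof -
  note fin = finite_matchings[OF assms] finite_matchings_avoiding[OF assms, of a]
  have ne: "matchings E \<noteq> {}" "matchings_avoiding E a \<noteq> {}"
    using empty_matching by blast+
  show "matching_poly E \<noteq> 0" "matching_poly_avoiding E a \<noteq> 0"
    using fin ne by (simp_all add: degree_card_poly)
  show "degree (matching_poly_avoiding E a) \<le> degree (matching_poly E)"
    using fin ne
    by (auto simp: degree_card_poly matchings_avoiding_def intro!: Max_mono)
  have "card M \<le> Suc (Max (card ` matchings_avoiding E a))" if M: "M \<in> matchings E" for M
  proof -
    let ?N = "{e \<in> M. a \<notin> e}"
    have finM: "finite M"
      using M assms finite_subset by (auto simp: matchings_def is_matching_def)
    have "?N \<in> matchings_avoiding E a"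
      using M by (auto simp: matchings_avoiding_def matchings_def is_matching_def)
    then have "card ?N \<le> Max (card ` matchings_avoiding E a)" using fin by auto
    moreover have "card {e \<in> M. a \<in> e} \<le> Suc 0"
    proof -
      have "e = f" if "e \<in> {e \<in> M. a \<in> e}" "f \<in> {e \<in> M. a \<in> e}" for e f
        using that M by (auto simp: matchings_def is_matching_def)
      then show ?thesis using finM card_le_Suc0_iff_eq[of "{e \<in> M. a \<in> e}"] by simp
    qed
    moreover have "card M = card ?N + card {e \<in> M. a \<in> e}"
    proof -
      have "M = ?N \<union> {e \<in> M. a \<in> e}" by auto
      then have "card M = card (?N \<union> {e \<in> M. a \<in> e})" by simp
      also have "\<dots> = card ?N + card {e \<in> M. a \<in> e}"
        using finM by (intro card_Un_disjoint) auto
      finally show ?thesis .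
    qed
    ultimately show ?thesis by linarith
  qed
  then have "Max (card ` matchings E) \<le> Suc (Max (card ` matchings_avoiding E a))"
    using fin ne by (intro Max.boundedI) auto
  then show "degree (matching_poly E) \<le> Suc (degree (matching_poly_avoiding E a))"
    using fin ne by (simp add: degree_card_poly)
qed

section \<open>Matchings of two graphs joined by an edge\<close>

context
  fixes A B :: "nat set" and E F :: "nat set set" and a b :: nat
  assumes fin: "finite A" "finite B" and disj: "A \<inter> B = {}"
    and E: "E \<subseteq> edges_on A" and F: "F \<subseteq> edges_on B" and a: "a \<in> A" and b: "b \<in> B"
begin

private lemma E_sub: "e \<in> E \<Longrightarrow> e \<subseteq> A \<and> \<not> e \<subseteq> B \<and> e \<noteq> {}"
  using disj by (elim edges_on_cases[OF E]) auto

private lemma F_sub: "e \<in> F \<Longrightarrow> e \<subseteq> B \<and> \<not> e \<subseteq> A \<and> e \<noteq> {}"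
  using disj by (elim edges_on_cases[OF F]) auto

private lemma ab_notin: "{a, b} \<notin> E" "{a, b} \<notin> F"
  using E_sub[of "{a, b}"] F_sub[of "{a, b}"] a b disj by auto

private lemma union_matching:
  assumes M: "M \<in> matchings E" and N: "N \<in> matchings F"
  shows "M \<union> N \<in> matchings (E \<union> F)"
proof -
  have MN: "e \<inter> f = {}" if "e \<in> M" "f \<in> N" for e f
  proof -
    have "e \<in> E" "f \<in> F" using that M N by (auto simp: matchings_iff)
    then have "e \<subseteq> A" "f \<subseteq> B" using E_sub F_sub by blast+
    then show ?thesis using disj by auto
  qed
  have "e \<inter> f = {}" if "e \<in> M \<union> N" "f \<in> M \<union> N" "e \<noteq> f" for e f
    using that M N MN[of e f] MN[of f e] unfolding matchings_iff
    by (elim UnE) (simp_all add: Int_commute)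
  moreover have "M \<union> N \<subseteq> E \<union> F" using M N by (auto simp: matchings_iff)
  ultimately show ?thesis by (simp only: matchings_iff) simp
qed

private lemma restrict_union:
  assumes "M \<subseteq> E" "N \<subseteq> F"
  shows "{e \<in> M \<union> N. e \<subseteq> A} = M" "{e \<in> M \<union> N. e \<subseteq> B} = N"
  using assms E_sub F_sub by blast+

private lemma card_union:
  assumes "M \<subseteq> E" "N \<subseteq> F"
  shows "card (M \<union> N) = card M + card N"
proof (rule card_Un_disjoint)
  show "finite M" "finite N"
    using assms finite_subset finite_edges fin E F by metis+
  show "M \<inter> N = {}" using assms E_sub F_sub by blast
qed

text \<open>Restricting a union to the edges inside \<open>A\<close> or inside \<open>B\<close>
  recovers the two matchings, so forming unions is injective. As sizes add, the sum over pairs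
  factors.\<close>

private lemma card_poly_union:
  assumes "\<M> \<subseteq> matchings E" "\<N> \<subseteq> matchings F"
  shows "card_poly ((\<lambda>(M, N). M \<union> N) ` (\<M> \<times> \<N>)) = card_poly \<M> * card_poly \<N>"
proof -
  have sub: "M \<subseteq> E" "N \<subseteq> F" if "M \<in> \<M>" "N \<in> \<N>" for M N
    using that assms by (auto simp: matchings_def is_matching_def)
  have "inj_on (\<lambda>(M, N). M \<union> N) (\<M> \<times> \<N>)"
  proof (rule inj_onI, clarify)
    fix M N M' N' assume *: "M \<in> \<M>" "N \<in> \<N>" "M' \<in> \<M>" "N' \<in> \<N>" "M \<union> N = M' \<union> N'"
    then show "M = M' \<and> N = N'" using restrict_union sub by metis
  qed
  then have "card_poly ((\<lambda>(M, N). M \<union> N) ` (\<M> \<times> \<N>)) =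
      (\<Sum>(M, N)\<in>\<M> \<times> \<N>. monom 1 (card (M \<union> N)))"
    by (simp add: card_poly_def sum.reindex split_def)
  also have "\<dots> = (\<Sum>(M, N)\<in>\<M> \<times> \<N>. monom 1 (card M) * monom 1 (card N))"
    using card_union sub by (intro sum.cong) (auto simp: mult_monom)
  also have "\<dots> = card_poly \<M> * card_poly \<N>"
    by (simp add: card_poly_def sum_product sum.cartesian_product)
  finally show ?thesis .
qed

private lemma matchings_without_edge:
  "{M \<in> matchings (join E a F b). {a, b} \<notin> M} =
    (\<lambda>(M, N). M \<union> N) ` (matchings E \<times> matchings F)" (is "?L = ?R")
proof
  show "?L \<subseteq> ?R"
  proof
    fix M assume "M \<in> ?L"
    then have M: "M = (M \<inter> E) \<union> (M \<inter> F)" "M \<inter> E \<in> matchings E" "M \<inter> F \<in> matchings F"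
      by (auto simp: matchings_def is_matching_def)
    then show "M \<in> ?R" by (intro image_eqI[of _ _ "(M \<inter> E, M \<inter> F)"]) auto
  qed
  show "?R \<subseteq> ?L"
    using union_matching ab_notin by (fastforce simp: matchings_def is_matching_def)
qed

private lemma matchings_with_edge:
  "{M \<in> matchings (join E a F b). {a, b} \<in> M} =
    insert {a, b} ` (\<lambda>(M, N). M \<union> N) ` (matchings_avoiding E a \<times> matchings_avoiding F b)"
  (is "?L = ?R")
proof
  show "?L \<subseteq> ?R"
  proof
    fix M assume M: "M \<in> ?L"
    then have sub: "M \<subseteq> insert {a, b} (E \<union> F)" and ab: "{a, b} \<in> M"
      by (auto simp: matchings_iff)
    have dj: "e \<inter> f = {}" if "e \<in> M" "f \<in> M" "e \<noteq> f" for e f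
      using that M by (auto simp: matchings_iff)
    have "a \<notin> e \<and> b \<notin> e" if "e \<in> M" "e \<in> E \<union> F" for e
      using dj[OF that(1) ab] ab_notin that by auto
    then have "M \<inter> E \<in> matchings_avoiding E a" "M \<inter> F \<in> matchings_avoiding F b"
      using dj by (auto simp: matchings_avoiding_iff matchings_iff)
    moreover have "M = insert {a, b} ((M \<inter> E) \<union> (M \<inter> F))"
      using sub ab by blast
    ultimately show "M \<in> ?R" by (metis (no_types, lifting) SigmaI image_eqI case_prod_conv)
  qed
  show "?R \<subseteq> ?L"
  proof
    fix K assume "K \<in> ?R"
    then obtain M N where K: "K = insert {a, b} (M \<union> N)"
      and MN: "M \<in> matchings_avoiding E a" "N \<in> matchings_avoiding F b" by auto
    then have M: "M \<in> matchings E" "N \<in> matchings F" by (simp_all add: matchings_avoiding_iff)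
    note U = union_matching[OF M]
    have sub: "M \<subseteq> E" "N \<subseteq> F" using M by (simp_all add: matchings_iff)
    have "a \<notin> e \<and> b \<notin> e" if "e \<in> M \<union> N" for e
    proof (cases "e \<in> M")
      case True
      then have "a \<notin> e" "e \<subseteq> A"
        using MN sub E_sub by (auto simp: matchings_avoiding_iff)
      then show ?thesis using b disj by blast
    next
      case False
      then have "b \<notin> e" "e \<subseteq> B"
        using that MN sub F_sub by (auto simp: matchings_avoiding_iff)
      then show ?thesis using a disj by blast
    qed
    then have "{a, b} \<inter> e = {}" "e \<inter> {a, b} = {}" if "e \<in> M \<union> N" for e
      using that by auto
    then show "K \<in> ?L"
      using U unfolding K matchings_iff by (simp add: le_supI1 subset_insertI2)
  qed
qed

text \<open>A matching that misses \<open>a\<close> cannot use the new edge, so its two parts are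
  independent and only the part in \<open>E\<close> is constrained.\<close>

lemma matching_poly_avoiding_join:
  "matching_poly_avoiding (join E a F b) a = matching_poly_avoiding E a * matching_poly F"
proof -
  have "matchings_avoiding (join E a F b) a =
      {M \<in> {M \<in> matchings (join E a F b). {a, b} \<notin> M}. a \<notin> \<Union>M}"
    by (auto simp: matchings_avoiding_def)
  also have "\<dots> = (\<lambda>(M, N). M \<union> N) ` (matchings_avoiding E a \<times> matchings F)"
  proof -
    have "a \<notin> \<Union>N" if "N \<in> matchings F" for N
      using that F_sub a disj unfolding matchings_def is_matching_def by blast
    then show ?thesis unfolding matchings_without_edge matchings_avoiding_def by auto
  qed
  finally have *: "matchings_avoiding (join E a F b) a = \<dots>" .
  show ?thesis
    unfolding * by (rule card_poly_union) (auto simp: matchings_avoiding_def)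
qed

text \<open>Split by whether the new edge is used. If it is, each part must miss its end of that
  edge, and the edge itself gives the factor \<open>monom 1 1\<close>.\<close>

lemma matching_poly_join:
  "matching_poly (join E a F b) =
    matching_poly E * matching_poly F +
    monom 1 1 * (matching_poly_avoiding E a * matching_poly_avoiding F b)"
proof -
  have finE: "finite E" "finite F" using finite_edges fin E F by blast+
  let ?J = "matchings (join E a F b)"
  let ?U = "(\<lambda>(M, N). M \<union> N) ` (matchings_avoiding E a \<times> matchings_avoiding F b)"
  have "?J = {M \<in> ?J. {a, b} \<notin> M} \<union> {M \<in> ?J. {a, b} \<in> M}" by blast
  then have "matching_poly (join E a F b) = card_poly ({M \<in> ?J. {a, b} \<notin> M} \<union> {M \<in> ?J. {a, b} \<in> M})"
    by simp
  also have "\<dots> = card_poly {M \<in> ?J. {a, b} \<notin> M} + card_poly {M \<in> ?J. {a, b} \<in> M}"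
    unfolding card_poly_def
    using finE by (intro sum.union_disjoint) (auto intro!: finite_matchings)
  also have "card_poly {M \<in> ?J. {a, b} \<notin> M} = matching_poly E * matching_poly F"
    unfolding matchings_without_edge by (rule card_poly_union) auto
  also have "card_poly {M \<in> ?J. {a, b} \<in> M} = (\<Sum>M\<in>?U. monom 1 (Suc (card M)))"
  proof -
    have sub: "M \<subseteq> E \<union> F" if "M \<in> ?U" for M
      using that by (auto simp: matchings_avoiding_def matchings_def is_matching_def)
    then have nin: "{a, b} \<notin> M" if "M \<in> ?U" for M using that ab_notin by blast
    then have "inj_on (insert {a, b}) ?U"
      by (intro inj_onI) (metis insert_ident)
    moreover have "card (insert {a, b} M) = Suc (card M)" if "M \<in> ?U" for M
      using nin[OF that] finite_subset[OF sub[OF that]] finE by simp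
    ultimately show ?thesis
      unfolding matchings_with_edge card_poly_def by (simp only: sum.reindex comp_def cong: sum.cong)
  qed
  also have "\<dots> = monom 1 1 * card_poly ?U"
    by (simp add: card_poly_def sum_distrib_left mult_monom)
  also have "card_poly ?U = matching_poly_avoiding E a * matching_poly_avoiding F b"
    by (rule card_poly_union) (auto simp: matchings_avoiding_def)
  finally show ?thesis .
qed

end

text \<open>Natural coefficients cannot cancel: a sum has the larger degree, and leading
  coefficients add when the degrees tie.\<close>

lemma lead_coeff_add_nat:
  fixes p q :: "nat poly"
  shows "degree (p + q) = max (degree p) (degree q)"
    and "lead_coeff (p + q) = (if degree q \<le> degree p then lead_coeff p else 0) +
      (if degree p \<le> degree q then lead_coeff q else 0)"
proof -
  have ge: "degree p \<le> degree (p + q)" for p q :: "nat poly"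
  proof (cases "p = 0")
    case False
    then have "coeff (p + q) (degree p) \<noteq> 0" by simp
    then show ?thesis by (rule le_degree)
  qed simp
  show deg: "degree (p + q) = max (degree p) (degree q)"
    using ge[of p q] ge[of q p] degree_add_le_max[of p q] by (simp add: add.commute)
  show "lead_coeff (p + q) = (if degree q \<le> degree p then lead_coeff p else 0) +
      (if degree p \<le> degree q then lead_coeff q else 0)"
    unfolding deg by (auto simp: max_def coeff_eq_0)
qed

section \<open>Recursion for rooted trees\<close>

text \<open>Let e_i = degree p_i - degree q_i, which is 0 or 1, and d = degree p1 + degree p2. The
  summands of \<open>p\<close> have degrees d and d + 1 - e_1 - e_2, so the first counts iff e_1 +
  e_2 >= 1 and the second iff e_1 + e_2 <= 1. The degree of \<open>q\<close> is d - e_1.\<close>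

lemma lead_coeff_join:
  fixes p1 q1 p2 q2 :: "nat poly"
  assumes nz: "p1 \<noteq> 0" "q1 \<noteq> 0" "p2 \<noteq> 0" "q2 \<noteq> 0"
    and deg: "degree q1 \<le> degree p1" "degree p1 \<le> Suc (degree q1)"
      "degree q2 \<le> degree p2" "degree p2 \<le> Suc (degree q2)"
  defines "p \<equiv> p1 * p2 + monom 1 1 * (q1 * q2)" and "q \<equiv> q1 * p2"
  shows "degree p \<noteq> degree q \<longleftrightarrow> degree p1 \<noteq> degree q1 \<or> degree p2 = degree q2"
    and "lead_coeff q = lead_coeff q1 * lead_coeff p2"
    and "lead_coeff p =
      of_bool (degree p1 \<noteq> degree q1 \<or> degree p2 \<noteq> degree q2) * (lead_coeff p1 * lead_coeff p2) +
      of_bool (degree p1 = degree q1 \<or> degree p2 = degree q2) * (lead_coeff q1 * lead_coeff q2)"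
proof -
  have m: "monom (1::nat) 1 \<noteq> 0" by (simp add: monom_eq_0_iff)
  have d: "degree (p1 * p2) = degree p1 + degree p2"
    "degree (monom 1 1 * (q1 * q2)) = Suc (degree q1 + degree q2)"
    "degree q = degree q1 + degree p2"
    using nz m by (simp_all add: q_def degree_mult_eq degree_monom_eq del: One_nat_def)
  have dp: "degree p = max (degree p1 + degree p2) (Suc (degree q1 + degree q2))"
    unfolding p_def by (simp only: lead_coeff_add_nat(1) d)
  show "degree p \<noteq> degree q \<longleftrightarrow> degree p1 \<noteq> degree q1 \<or> degree p2 = degree q2"
    unfolding dp d using deg by linarith
  show "lead_coeff q = lead_coeff q1 * lead_coeff p2"
    unfolding q_def by (rule lead_coeff_mult)
  have "lead_coeff (monom 1 1 * (q1 * q2)) = lead_coeff q1 * lead_coeff q2"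
    by (simp only: lead_coeff_mult lead_coeff_monom mult_1)
  moreover have "lead_coeff (p1 * p2) = lead_coeff p1 * lead_coeff p2"
    by (rule lead_coeff_mult)
  ultimately show "lead_coeff p =
      of_bool (degree p1 \<noteq> degree q1 \<or> degree p2 \<noteq> degree q2) * (lead_coeff p1 * lead_coeff p2) +
      of_bool (degree p1 = degree q1 \<or> degree p2 = degree q2) * (lead_coeff q1 * lead_coeff q2)"
    unfolding p_def lead_coeff_add_nat(2) d using deg by auto
qed

text \<open>A root is essential if every maximum matching covers it; otherwise deleting the root does not
  decrease the matching number. The weights below count maximum matchings of the tree
  (\<open>ess\<close>, \<open>iness\<close>) and maximum ones among the matchings that miss the root (\<open>ess0\<close>, \<open>iness0\<close>),
  each restricted to one type of root.\<close>

definition essential :: "nat set set \<Rightarrow> nat \<Rightarrow> bool" where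
  "essential E a \<longleftrightarrow> degree (matching_poly E) \<noteq> degree (matching_poly_avoiding E a)"

definition ess :: "nat set set \<Rightarrow> nat \<Rightarrow> real" where
  "ess E a = of_bool (essential E a) * real (lead_coeff (matching_poly E))"

definition iness :: "nat set set \<Rightarrow> nat \<Rightarrow> real" where
  "iness E a = of_bool (\<not> essential E a) * real (lead_coeff (matching_poly E))"

definition ess0 :: "nat set set \<Rightarrow> nat \<Rightarrow> real" where
  "ess0 E a = of_bool (essential E a) * real (lead_coeff (matching_poly_avoiding E a))"

definition iness0 :: "nat set set \<Rightarrow> nat \<Rightarrow> real" where
  "iness0 E a = of_bool (\<not> essential E a) * real (lead_coeff (matching_poly_avoiding E a))"

text \<open>Each weight vanishes on roots of the other type, so the cases of
  \<open>lead_coeff_join\<close> merge into sums of products. For two inessential roots, for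
  example, exactly the matchings through the new edge can be maximum, and \<open>a\<close> becomes
  essential.\<close>

lemma weights_join:
  assumes fin: "finite A" "finite B" and disj: "A \<inter> B = {}"
    and TA: "tree_on A E" and TB: "tree_on B F" and a: "a \<in> A" and b: "b \<in> B"
  defines "J \<equiv> join E a F b"
  shows "ess J a = ess E a * (ess F b + iness F b) + (ess0 E a + iness0 E a) * iness0 F b"
    and "iness J a = iness E a * ess F b + iness0 E a * ess0 F b"
    and "ess0 J a = ess0 E a * (ess F b + iness F b) + iness0 E a * iness F b"
    and "iness0 J a = iness0 E a * ess F b"
proof -
  have sub: "E \<subseteq> edges_on A" "F \<subseteq> edges_on B" using TA TB by (auto simp: tree_on_def)
  have finE: "finite E" "finite F" using finite_edges fin sub by blast+
  note join = matching_poly_join[OF fin disj sub a b] matching_poly_avoiding_join[OF fin disj sub a b]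
  have E: "matching_poly E \<noteq> 0" "matching_poly_avoiding E a \<noteq> 0"
      "degree (matching_poly_avoiding E a) \<le> degree (matching_poly E)"
      "degree (matching_poly E) \<le> Suc (degree (matching_poly_avoiding E a))"
    and F: "matching_poly F \<noteq> 0" "matching_poly_avoiding F b \<noteq> 0"
      "degree (matching_poly_avoiding F b) \<le> degree (matching_poly F)"
      "degree (matching_poly F) \<le> Suc (degree (matching_poly_avoiding F b))"
    by (rule degree_matching_poly[OF finE(1)] degree_matching_poly[OF finE(2)])+
  note * = lead_coeff_join[OF E(1,2) F(1,2) E(3,4) F(3,4)]
  have 1: "essential J a \<longleftrightarrow> essential E a \<or> \<not> essential F b"
    unfolding essential_def J_def join * by simp
  have 2: "lead_coeff (matching_poly_avoiding J a) =
      lead_coeff (matching_poly_avoiding E a) * lead_coeff (matching_poly F)"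
    unfolding J_def join * by simp
  have 3: "lead_coeff (matching_poly J) =
      of_bool (essential E a \<or> essential F b) * (lead_coeff (matching_poly E) * lead_coeff (matching_poly F)) +
      of_bool (\<not> essential E a \<or> \<not> essential F b) *
        (lead_coeff (matching_poly_avoiding E a) * lead_coeff (matching_poly_avoiding F b))"
    unfolding essential_def J_def join * by simp
  show "ess J a = ess E a * (ess F b + iness F b) + (ess0 E a + iness0 E a) * iness0 F b"
    "iness J a = iness E a * ess F b + iness0 E a * ess0 F b"
    "ess0 J a = ess0 E a * (ess F b + iness F b) + iness0 E a * iness F b"
    "iness0 J a = iness0 E a * ess F b"
    unfolding ess_def iness_def ess0_def iness0_def 1 2 3
    by (cases "essential E a"; cases "essential F b"; simp)+
qed

section \<open>Sums over rooted trees and their generating functions\<close>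

definition rooted_sum :: "(nat set set \<Rightarrow> nat \<Rightarrow> real) \<Rightarrow> nat set \<Rightarrow> real" where
  "rooted_sum w S = (\<Sum>E | tree_on S E. \<Sum>a\<in>S. w E a)"

lemma rooted_sum_empty [simp]: "rooted_sum w {} = 0"
  by (simp add: rooted_sum_def)

lemma rooted_sum_add:
  "rooted_sum (\<lambda>E a. v E a + w E a) S = rooted_sum v S + rooted_sum w S"
  by (simp add: rooted_sum_def sum.distrib)

text \<open>All four weights fit this shape, so the recursion is proved once. The \<open>u\<close>
  weights belong to the part that keeps the root, the \<open>v\<close> weights to the part cut
  off.\<close>

definition join_rule where
  "join_rule w u1 v1 u2 v2 \<longleftrightarrow> (\<forall>A B E F a b. finite A \<longrightarrow> finite B \<longrightarrow> A \<inter> B = {} \<longrightarrow>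
     tree_on A E \<longrightarrow> tree_on B F \<longrightarrow> a \<in> A \<longrightarrow> b \<in> B \<longrightarrow>
     (w (join E a F b) a :: real) = u1 E a * v1 F b + u2 E a * v2 F b)"

lemma join_ruleD:
  assumes "join_rule w u1 v1 u2 v2" "finite A" "finite B" "A \<inter> B = {}"
    "tree_on A E" "tree_on B F" "a \<in> A" "b \<in> B"
  shows "w (join E a F b) a = u1 E a * v1 F b + u2 E a * v2 F b"
  using assms unfolding join_rule_def by blast

text \<open>By \<open>sum_card_side\<close> the factor \<open>card S - 1\<close> is a sum over the
  edges at the root, which creates the marked edge that \<open>sum_edge_split\<close> cuts.\<close>

lemma rooted_sum_rec:
  assumes fin: "finite S" and w: "join_rule w u1 v1 u2 v2"
  shows "real (card S - 1) * rooted_sum w S = (\<Sum>B\<in>Pow S. real (card B) *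
    (rooted_sum u1 (S - B) * rooted_sum v1 B + rooted_sum u2 (S - B) * rooted_sum v2 B))"
proof -
  have "real (card S - 1) * rooted_sum w S =
      (\<Sum>E | tree_on S E. \<Sum>a\<in>S. real (\<Sum>b | (a, b) \<in> adj_rel E. card (side E a b)) * w E a)"
    using sum_card_side[OF fin] by (simp add: rooted_sum_def sum_distrib_left)
  also have "\<dots> = (\<Sum>E | tree_on S E. \<Sum>a\<in>S. \<Sum>b | (a, b) \<in> adj_rel E.
      real (card (side E a b)) * w E a)"
    by (simp add: sum_distrib_right)
  also have "\<dots> = (\<Sum>B\<in>Pow S. \<Sum>E | tree_on (S - B) E. \<Sum>a\<in>S - B. \<Sum>F | tree_on B F. \<Sum>b\<in>B.
      real (card (side (join E a F b) a b)) * w (join E a F b) a)"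
    by (rule sum_edge_split[OF fin])
  also have "\<dots> = (\<Sum>B\<in>Pow S. \<Sum>E | tree_on (S - B) E. \<Sum>a\<in>S - B. \<Sum>F | tree_on B F. \<Sum>b\<in>B.
      real (card B) * (u1 E a * v1 F b + u2 E a * v2 F b))"
  proof (intro sum.cong refl)
    fix B E a F b
    assume *: "B \<in> Pow S" "E \<in> {E. tree_on (S - B) E}" "a \<in> S - B" "F \<in> {F. tree_on B F}" "b \<in> B"
    then have fins: "finite (S - B)" "finite B" "(S - B) \<inter> B = {}"
      using fin finite_subset by auto
    have "side (join E a F b) a b = B"
      using * by (intro tree_on_join(2)[OF fins]) auto
    moreover have "w (join E a F b) a = u1 E a * v1 F b + u2 E a * v2 F b"
      using * by (intro join_ruleD[OF w fins]) auto
    ultimately show "real (card (side (join E a F b) a b)) * w (join E a F b) a =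
        real (card B) * (u1 E a * v1 F b + u2 E a * v2 F b)"
      by simp
  qed
  also have "\<dots> = (\<Sum>B\<in>Pow S. real (card B) *
    (rooted_sum u1 (S - B) * rooted_sum v1 B + rooted_sum u2 (S - B) * rooted_sum v2 B))"
  proof (rule sum.cong[OF refl])
    fix B
    have "(\<Sum>E | tree_on (S - B) E. \<Sum>a\<in>S - B. \<Sum>F | tree_on B F. \<Sum>b\<in>B.
        real (card B) * (u1 E a * v1 F b + u2 E a * v2 F b)) =
      (\<Sum>E | tree_on (S - B) E. \<Sum>a\<in>S - B.
        real (card B) * (u1 E a * rooted_sum v1 B + u2 E a * rooted_sum v2 B))"
      by (simp add: rooted_sum_def sum.distrib flip: sum_distrib_left)
    also have "\<dots> = real (card B) *
      (rooted_sum u1 (S - B) * rooted_sum v1 B + rooted_sum u2 (S - B) * rooted_sum v2 B)"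
      by (simp add: rooted_sum_def[of u1] rooted_sum_def[of u2] sum.distrib
          flip: sum_distrib_left sum_distrib_right)
    finally show "(\<Sum>E | tree_on (S - B) E. \<Sum>a\<in>S - B. \<Sum>F | tree_on B F. \<Sum>b\<in>B.
        real (card B) * (u1 E a * v1 F b + u2 E a * v2 F b)) = \<dots>" .
  qed
  finally show ?thesis .
qed

lemma sum_Pow_card:
  fixes g :: "nat \<Rightarrow> real"
  assumes "finite S"
  shows "(\<Sum>B\<in>Pow S. g (card B)) = (\<Sum>k\<le>card S. real (card S choose k) * g k)"
proof -
  have "(\<Sum>B\<in>Pow S. g (card B)) = (\<Sum>k\<le>card S. \<Sum>B\<in>{B \<in> Pow S. card B = k}. g (card B))"
    using assms by (intro sum.group[symmetric]) (auto intro: card_mono)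
  also have "\<dots> = (\<Sum>k\<le>card S. real (card S choose k) * g k)"
    using n_subsets[OF assms] by (intro sum.cong) simp_all
  finally show ?thesis .
qed

text \<open>Binomial convolution of exponential generating functions, in which the size of the
  cut-off part becomes \<open>fps_XD\<close>.\<close>

lemma sum_Pow_fps:
  fixes V W :: "real fps"
  assumes "finite S"
  shows "(\<Sum>B\<in>Pow S. real (card B) * ((fact (card (S - B)) * V $ card (S - B)) *
      (fact (card B) * W $ card B))) = fact (card S) * (V * fps_XD W) $ card S"
proof -
  let ?n = "card S"
  have "(\<Sum>B\<in>Pow S. real (card B) * ((fact (card (S - B)) * V $ card (S - B)) *
      (fact (card B) * W $ card B))) =
    (\<Sum>B\<in>Pow S. real (card B) * ((fact (?n - card B) * V $ (?n - card B)) *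
      (fact (card B) * W $ card B)))"
  proof (intro sum.cong refl)
    fix B assume "B \<in> Pow S"
    then have "card (S - B) = ?n - card B"
      using assms finite_subset[of B S] by (intro card_Diff_subset) auto
    then show "real (card B) * ((fact (card (S - B)) * V $ card (S - B)) *
        (fact (card B) * W $ card B)) =
      real (card B) * ((fact (?n - card B) * V $ (?n - card B)) * (fact (card B) * W $ card B))"
      by (simp only:)
  qed
  also have "\<dots> = (\<Sum>k\<le>?n. real (?n choose k) * (real k * ((fact (?n - k) * V $ (?n - k)) *
      (fact k * W $ k))))"
    by (rule sum_Pow_card[OF assms])
  also have "\<dots> = (\<Sum>k\<le>?n. fact ?n * (fps_XD W $ k * V $ (?n - k)))"
  proof (intro sum.cong refl)
    fix k assume "k \<in> {..?n}"
    then have f: "fact k * fact (?n - k) * real (?n choose k) = fact ?n"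
      using binomial_fact_lemma[of k ?n] by (metis atMost_iff of_nat_fact of_nat_mult)
    show "real (?n choose k) * (real k * ((fact (?n - k) * V $ (?n - k)) * (fact k * W $ k))) =
        fact ?n * (fps_XD W $ k * V $ (?n - k))"
      unfolding f[symmetric] by (simp add: algebra_simps)
  qed
  also have "\<dots> = fact ?n * (fps_XD W * V) $ ?n"
    by (simp add: fps_mult_nth sum_distrib_left atLeast0AtMost)
  finally show ?thesis by (simp only: mult.commute)
qed

text \<open>The right-hand side of the recursion only involves proper subsets, and
  \<open>2 <= card S\<close> allows cancelling the factor \<open>card S - 1\<close>.\<close>

lemma rooted_sum_step:
  assumes fin: "finite S" and S: "2 \<le> card S" and w: "join_rule w u1 v1 u2 v2"
    and W: "fps_XD W - W = U1 * fps_XD V1 + U2 * fps_XD V2"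
    and IH: "\<And>B u U. B \<subset> S \<Longrightarrow> (u, U) \<in> {(u1, U1), (v1, V1), (u2, U2), (v2, V2)} \<Longrightarrow>
      rooted_sum u B = fact (card B) * U $ card B"
  shows "rooted_sum w S = fact (card S) * W $ card S"
proof -
  let ?g = "\<lambda>U V B. real (card B) * ((fact (card (S - B)) * U $ card (S - B)) *
      (fact (card B) * V $ card B))"
  have S0: "{} \<subset> S" using S by auto
  have *: "real (card B) * (rooted_sum u (S - B) * rooted_sum v B) = ?g U V B"
    if B: "B \<in> Pow S" and uv: "(u, U) \<in> {(u1, U1), (u2, U2)}" "(v, V) \<in> {(v1, V1), (v2, V2)}"
    for B u v U V
  proof -
    have u: "rooted_sum u C = fact (card C) * U $ card C" if "C \<subset> S" for C
      using IH[OF that, of u U] uv by auto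
    have v: "rooted_sum v C = fact (card C) * V $ card C" if "C \<subset> S" for C
      using IH[OF that, of v V] uv by auto
    \<comment> \<open>For \<open>B = {}\<close> the factor \<open>card B\<close> vanishes. For
      \<open>B = S\<close> the other part is empty and \<open>U\<close> has constant term 0. So the
      unknown value at \<open>S\<close> drops out.\<close>
    consider "B = {}" | "B = S" | "B \<subset> S" "S - B \<subset> S" using B by blast
    then show ?thesis
    proof cases
      case 2
      have "U $ 0 = 0" using u[OF S0] by simp
      with 2 show ?thesis by simp
    qed (simp_all add: u v)
  qed
  have "real (card S - 1) * rooted_sum w S = (\<Sum>B\<in>Pow S. ?g U1 V1 B + ?g U2 V2 B)"
    unfolding rooted_sum_rec[OF fin w] distrib_left
    by (intro sum.cong refl arg_cong2[of _ _ _ _ "(+)"] *) auto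
  also have "\<dots> = fact (card S) * (U1 * fps_XD V1 + U2 * fps_XD V2) $ card S"
    by (simp add: sum.distrib sum_Pow_fps[OF fin] distrib_left)
  also have "\<dots> = fact (card S) * (real (card S - 1) * W $ card S)"
    using S by (simp add: W[symmetric] of_nat_diff algebra_simps)
  finally show ?thesis using S by simp
qed

lemma join_rules:
  "join_rule ess ess (\<lambda>E a. ess E a + iness E a) (\<lambda>E a. ess0 E a + iness0 E a) iness0"
  "join_rule iness iness ess iness0 ess0"
  "join_rule ess0 ess0 (\<lambda>E a. ess E a + iness E a) iness0 iness"
  "join_rule iness0 iness0 ess (\<lambda>E a. 0) (\<lambda>E a. 0)"
  unfolding join_rule_def by (auto simp: weights_join)

lemma tree_on_singleton: "tree_on {v} E \<longleftrightarrow> E = {}"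
proof -
  have "edges_on {v} = {}" by (auto simp: edges_on_def)
  then show ?thesis by (auto simp: tree_on_def connected_on_def)
qed

lemma matching_poly_empty: "matching_poly {} = 1" "matching_poly_avoiding {} a = 1"
proof -
  have "matchings {} = {{}}" "matchings_avoiding {} a = {{}}"
    by (auto simp: matchings_iff matchings_avoiding_iff)
  then show "matching_poly {} = 1" "matching_poly_avoiding {} a = 1"
    by (simp_all add: card_poly_def monom_eq_1 del: One_nat_def)
qed

text \<open>From index 2 on, the system fixes each coefficient by smaller ones. At index 1 the
  factor n - 1 vanishes, so the values for a single vertex are prescribed: its root is inessential
  and the empty matching is the only one.\<close>

lemma rooted_sum_eq_fps:
  fixes A B A0 B0 :: "real fps"
  assumes 0: "A $ 0 = 0" "B $ 0 = 0" "A0 $ 0 = 0" "B0 $ 0 = 0"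
    and 1: "A $ 1 = 0" "B $ 1 = 1" "A0 $ 1 = 0" "B0 $ 1 = 1"
    and ode: "fps_XD A - A = A * fps_XD (A + B) + (A0 + B0) * fps_XD B0"
      "fps_XD B - B = B * fps_XD A + B0 * fps_XD A0"
      "fps_XD A0 - A0 = A0 * fps_XD (A + B) + B0 * fps_XD B"
      "fps_XD B0 - B0 = B0 * fps_XD A"
    and "finite S"
  shows "rooted_sum ess S = fact (card S) * A $ card S \<and>
    rooted_sum iness S = fact (card S) * B $ card S \<and>
    rooted_sum ess0 S = fact (card S) * A0 $ card S \<and>
    rooted_sum iness0 S = fact (card S) * B0 $ card S"
  using \<open>finite S\<close>
proof (induction S rule: finite_psubset_induct)
  case (psubset S)
  consider "card S = 0" | "card S = 1" | "2 \<le> card S" by linarith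
  then show ?case
  proof cases
    case 1
    then show ?thesis using psubset.hyps 0 by simp
  next
    case 2
    then obtain v where "S = {v}" by (auto simp: card_1_singleton_iff)
    then show ?thesis
      using 1 by (simp add: rooted_sum_def tree_on_singleton ess_def iness_def ess0_def
          iness0_def essential_def matching_poly_empty)
  next
    case 3
    note IH = psubset.IH
    have AB: "rooted_sum (\<lambda>E a. ess E a + iness E a) T = fact (card T) * (A + B) $ card T"
      "rooted_sum (\<lambda>E a. ess0 E a + iness0 E a) T = fact (card T) * (A0 + B0) $ card T"
      if "T \<subset> S" for T
      using IH[OF that] by (simp_all add: rooted_sum_add distrib_left)
    have Z: "rooted_sum (\<lambda>E a. 0) T = fact (card T) * (0 :: real fps) $ card T" for T
      by (simp add: rooted_sum_def)
    show ?thesis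
      using IH AB Z ode
      by (intro conjI rooted_sum_step[OF psubset.hyps 3 join_rules(1)]
          rooted_sum_step[OF psubset.hyps 3 join_rules(2)]
          rooted_sum_step[OF psubset.hyps 3 join_rules(3)]
          rooted_sum_step[OF psubset.hyps 3 join_rules(4), where ?U2.0 = 0 and ?V2.0 = 0])
        (auto simp del: fps_add_nth fps_zero_nth)
  qed
qed

section \<open>From rooted sums to the counts \<open>N_m\<close>\<close>

lemma N_m_eq_sum:
  "N_m n = (\<Sum>E | tree_on {1..n} E. lead_coeff (matching_poly E))"
proof -
  have fin: "finite E" if "tree_on {1..n} E" for E
    using that finite_edges[of "{1..n}" E] by (simp add: tree_on_def)
  have "finite {M. is_max_matching E M}" if "tree_on {1..n} E" for E
    by (rule finite_subset[OF _ finite_matchings[OF fin[OF that]]])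
      (auto simp: is_max_matching_def matchings_def)
  then have "card (SIGMA E:{E. tree_on {1..n} E}. {M. is_max_matching E M}) =
      (\<Sum>E | tree_on {1..n} E. card {M. is_max_matching E M})"
    by (intro card_SigmaI) (auto simp: finite_trees)
  moreover have "{(E, M). is_labeled_tree n E \<and> is_max_matching E M} =
      (SIGMA E:{E. tree_on {1..n} E}. {M. is_max_matching E M})"
    by (auto simp: is_labeled_tree_iff)
  ultimately show ?thesis
    using fin by (simp add: N_m_def card_max_matchings)
qed

text \<open>Each tree has \<open>n\<close> possible roots, and for every root the two types together
  give the number of maximum matchings.\<close>

lemma mult_N_m: "real n * real (N_m n) = rooted_sum ess {1..n} + rooted_sum iness {1..n}"
proof -
  have "ess E a + iness E a = real (lead_coeff (matching_poly E))" for E a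
    by (simp add: ess_def iness_def)
  then have "rooted_sum (\<lambda>E a. ess E a + iness E a) {1..n} = real n * real (N_m n)"
    by (simp add: rooted_sum_def N_m_eq_sum sum_distrib_left)
  then show ?thesis by (simp add: rooted_sum_add)
qed

section \<open>Solving the recursion\<close>

lemma fps_XD_mult: "fps_XD (V * W) = fps_XD V * W + V * fps_XD (W :: real fps)"
  by (simp add: fps_XD_def algebra_simps)

lemma fps_XD_diff: "fps_XD (V - W) = fps_XD V - fps_XD (W :: real fps)"
  by (simp add: fps_XD_def algebra_simps)

lemma fps_XD_const: "fps_XD (fps_const c :: real fps) = 0"
  by (simp add: fps_XD_def)

lemma fps_XD_X: "fps_XD (fps_X :: real fps) = fps_X"
  by (simp add: fps_XD_def)

lemma fps_XD_fexp: "U $ 0 = 0 \<Longrightarrow> fps_XD (fexp U) = fexp U * fps_XD U"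
  by (simp add: fps_XD_def fps_deriv_fexp algebra_simps)

text \<open>For the fixed point U, with y, z and B as in \<open>ode_solution\<close>, this is (U +
  B) - (U^2 + 2UB)/2 - (yz - y^2/2): trees with a marked vertex minus trees with a marked edge. The
  marked edge is either outside the matching (its ends not both inessential in their parts) or in it
  (not both essential). A tree has one more vertex than edges.\<close>

definition matching_formula :: "real fps \<Rightarrow> real fps" where
  "matching_formula U = - fps_const (1/2) * (fps_X * fexp U + U) ^ 2
     + (1 + U * fps_X * fexp U) * (fps_X * fexp U) + U - U ^ 2"

text \<open>\<open>U\<close>, \<open>B\<close>, \<open>z - y\<close> and \<open>y\<close> are the exponential generating functions of \<open>ess\<close>, \<open>iness\<close>,
  \<open>ess0\<close> and \<open>iness0\<close>; \<open>z\<close> is the one of \<open>ess0 + iness0\<close>.\<close>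

lemma ode_solution:
  fixes U :: "real fps"
  assumes U0: "U $ 0 = 0" and fp: "U = matching_step U"
  defines "y \<equiv> fps_X * fexp U"
  defines "B \<equiv> y + U - y\<^sup>2"
  defines "z \<equiv> fps_X * fexp (U + B)"
  shows "U = y * z"
    and "U $ 0 = 0" "B $ 0 = 0" "(z - y) $ 0 = 0" "y $ 0 = 0"
    and "U $ 1 = 0" "B $ 1 = 1" "(z - y) $ 1 = 0" "y $ 1 = 1"
    and "fps_XD U - U = U * fps_XD (U + B) + ((z - y) + y) * fps_XD y"
    and "fps_XD B - B = B * fps_XD U + y * fps_XD (z - y)"
    and "fps_XD (z - y) - (z - y) = (z - y) * fps_XD (U + B) + y * fps_XD B"
    and "fps_XD y - y = y * fps_XD U"
    and "fps_XD (matching_formula U) = U + B" 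
proof -
  have y0: "y $ 0 = 0" and z0: "z $ 0 = 0" by (simp_all add: y_def z_def)
  have B0: "B $ 0 = 0" using U0 y0 by (simp add: B_def power2_eq_square)
  have "fexp (2 * U) = fexp U * fexp U"
    by (simp only: mult_2 fexp_add[OF U0 U0])
  then have "matching_step U = fps_X ^ 2 * fexp (- y\<^sup>2 + y + 3 * U)"
    by (simp add: matching_step_def y_def power2_eq_square mult_ac)
  with fp have "U = fps_X ^ 2 * fexp (- y\<^sup>2 + y + 3 * U)"
    by (rule trans)
  \<comment> \<open>The exponent of the functional equation splits into the exponents of
    \<open>y\<close> and \<open>z\<close>.\<close>
  also have "- y\<^sup>2 + y + 3 * U = U + (U + B)" by (simp add: B_def)
  also have "fexp (U + (U + B)) = fexp U * fexp (U + B)"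
    using U0 B0 by (intro fexp_add) simp_all
  also have "fps_X ^ 2 * \<dots> = y * z"
    by (simp only: y_def z_def power2_eq_square mult_ac)
  finally show U: "U = y * z" .
  have y1: "y $ 1 = 1" and z1: "z $ 1 = 1" by (simp_all add: y_def z_def fps_X_mult_nth)
  have U1: "U $ 1 = 0" using y0 z0 by (subst U) (simp add: fps_mult_nth)
  show "U $ 0 = 0" "B $ 0 = 0" "(z - y) $ 0 = 0" "y $ 0 = 0"
    "U $ 1 = 0" "B $ 1 = 1" "(z - y) $ 1 = 0" "y $ 1 = 1"
    by (fact U0 B0 y0 U1 y1)+ (use U0 y0 z0 y1 z1 U1 in
      \<open>simp_all add: B_def power2_eq_square fps_mult_nth\<close>)
  have Dy: "fps_XD y = y + y * fps_XD U"
    by (simp add: y_def fps_XD_mult fps_XD_X fps_XD_fexp[OF U0] algebra_simps)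
  have Dz: "fps_XD z = z + z * fps_XD (U + B)"
    using U0 B0 by (simp add: z_def fps_XD_mult fps_XD_X fps_XD_fexp algebra_simps)
  have DU: "fps_XD U = fps_XD y * z + y * fps_XD z"
    by (subst U) (rule fps_XD_mult)
  have DB: "fps_XD B = fps_XD y + fps_XD U - 2 * y * fps_XD y"
    by (simp add: B_def fps_XD_diff power2_eq_square fps_XD_mult algebra_simps)
  show "fps_XD y - y = y * fps_XD U" using Dy by simp
  show "fps_XD U - U = U * fps_XD (U + B) + ((z - y) + y) * fps_XD y"
    unfolding fps_XD_add using DU Dz U fps_XD_add[of U B] by algebra
  \<comment> \<open>As B = y(1 + z - y), the term \<open>B * fps_XD U\<close> equals (1 + z - y)
    times \<open>fps_XD y - y\<close>, and a polynomial identity remains.\<close>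
  have By: "B = y + y * z - y * y" using U by (simp add: B_def power2_eq_square)
  have DBy: "fps_XD B = fps_XD y + (fps_XD y * z + y * fps_XD z) - 2 * y * fps_XD y"
    using DB DU by simp
  show "fps_XD B - B = B * fps_XD U + y * fps_XD (z - y)"
    unfolding fps_XD_diff using By DBy Dy by algebra
  show "fps_XD (z - y) - (z - y) = (z - y) * fps_XD (U + B) + y * fps_XD B"
    using Dz Dy by (simp add: fps_XD_diff algebra_simps)
  \<comment> \<open>To \<open>algebra\<close> the constant \<open>fps_const (1/2)\<close> is an
    atom. Its product with 2 is therefore displayed in the derivative below and rewritten to 1 by
    this fact.\<close>
  have half: "fps_const (1/2) * 2 = (1 :: real fps)"
    by (simp add: numeral_fps_const)
  have mf: "matching_formula U = y + U * y * y + U - U * U - fps_const (1/2) * ((y + U) * (y + U))"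
    by (simp add: matching_formula_def y_def power2_eq_square algebra_simps flip: fps_const_neg)
  have "fps_XD (matching_formula U) = fps_XD y + ((fps_XD U * y + U * fps_XD y) * y +
      U * y * fps_XD y) + fps_XD U - 2 * (U * fps_XD U) -
      fps_const (1/2) * 2 * ((y + U) * (fps_XD y + fps_XD U))"
    unfolding mf fps_XD_diff fps_XD_add fps_XD_mult fps_XD_const by algebra
  also have "\<dots> = U + B"
    unfolding half B_def power2_eq_square
    using Dy DU Dz[unfolded fps_XD_add] U DB by algebra
  finally show "fps_XD (matching_formula U) = U + B" .
qed

lemma N_m_coeff:
  assumes "U $ 0 = 0" "U = matching_step U"
  defines "B \<equiv> fps_X * fexp U + U - (fps_X * fexp U)\<^sup>2"
  shows "real n * real (N_m n) = fact n * (U + B) $ n"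
  using rooted_sum_eq_fps[OF ode_solution(2-13)[OF assms(1,2)] finite_atLeastAtMost, of 1 n]
  unfolding mult_N_m B_def[symmetric] by (simp only: card_atLeastAtMost diff_Suc_1 distrib_left fps_add_nth)

lemma F_m_eq:
  assumes U: "U $ 0 = 0" "U = matching_step U"
  shows "F_m = matching_formula U"
proof (rule fps_ext)
  fix n
  show "F_m $ n = matching_formula U $ n"
  \<comment> \<open>\<open>fps_XD\<close> forgets the constant term, so it is compared separately;
    it is 0 on both sides.\<close>
  proof (cases "n = 0")
    case True
    then show ?thesis using U(1) by (simp add: F_m_def matching_formula_def power2_eq_square)
  next
    case False
    have "fact n * (real n * F_m $ n) = real n * real (N_m n)"
      using False by (simp add: F_m_def)
    also have "\<dots> = fact n * fps_XD (matching_formula U) $ n"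
      by (simp only: N_m_coeff[OF U] ode_solution(14)[OF U])
    finally show ?thesis using False by simp
  qed
qed

section \<open>The first ten values\<close>

lemma ode_coeff:
  fixes U1 V1 U2 V2 W :: "real fps"
  assumes "fps_XD W - W = U1 * fps_XD V1 + U2 * fps_XD V2"
  shows "(real n - 1) * W $ n = (\<Sum>k\<le>n. U1 $ k * (real (n - k) * V1 $ (n - k))) +
    (\<Sum>k\<le>n. U2 $ k * (real (n - k) * V2 $ (n - k)))"
proof -
  have "(real n - 1) * W $ n = (fps_XD W - W) $ n" by (simp add: algebra_simps)
  also have "\<dots> = (U1 * fps_XD V1) $ n + (U2 * fps_XD V2) $ n" by (simp only: assms fps_add_nth)
  finally show ?thesis by (simp add: fps_mult_nth atLeast0AtMost)
qed

text \<open>The coefficients are computed from the differential system: all constant terms are 0, so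
  index n on the right involves smaller indices only, and no exponential has to be expanded.\<close>

lemma N_m_values:
  "map N_m [1..<11] = [1, 1, 6, 24, 320, 3270, 55482, 999656, 21718440, 544829130]"
proof -
  obtain U where U: "U $ 0 = 0" "U = matching_step U" using ex1_matching_step_fixpoint by blast
  define B where "B = fps_X * fexp U + U - (fps_X * fexp U)\<^sup>2"
  define A where "A = U"
  define B0 where "B0 = fps_X * fexp U"
  define A0 where "A0 = fps_X * fexp (U + B) - B0"
  note ode = ode_solution[OF U, folded B_def, folded B0_def, folded A0_def, folded A_def]
  have B0_eq: "fps_XD B0 - B0 = B0 * fps_XD A + 0 * fps_XD 0" using ode(13) by simp
  note rec = ode_coeff[OF ode(10)] ode_coeff[OF ode(11)] ode_coeff[OF ode(12)] ode_coeff[OF B0_eq]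
  note v = ode(2-9)[simplified One_nat_def] atMost_nat_numeral atMost_Suc
  have v2: "A $ 2 = 1" "B $ 2 = 0" "A0 $ 2 = 1" "B0 $ 2 = 0"
    using rec[of 2] by (simp_all add: v)
  note v = v v2
  have v3: "A $ 3 = 1" "B $ 3 = 2" "A0 $ 3 = 1/2" "B0 $ 3 = 1"
    using rec[of 3] by (simp_all add: v)
  note v = v v3
  have v4: "A $ 4 = 5/2" "B $ 4 = 3/2" "A0 $ 4 = 19/6" "B0 $ 4 = 1"
    using rec[of 4] by (simp_all add: v)
  note v = v v4
  have v5: "A $ 5 = 37/6" "B $ 5 = 43/6" "A0 $ 5 = 121/24" "B0 $ 5 = 3"
    using rec[of 5] by (simp_all add: v)
  note v = v v5
  have v6: "A $ 6 = 325/24" "B $ 6 = 329/24" "A0 $ 6 = 1841/120" "B0 $ 6 = 43/6"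
    using rec[of 6] by (simp_all add: v)
  note v = v v6
  have v7: "A $ 7 = 4601/120" "B $ 7 = 2323/60" "A0 $ 7 = 27601/720" "B0 $ 7 = 401/24"
    using rec[of 7] by (simp_all add: v)
  note v = v v7
  have v8: "A $ 8 = 68851/720" "B $ 8 = 73957/720" "A0 $ 8 = 102161/1008" "B0 $ 8 = 5701/120"
    using rec[of 8] by (simp_all add: v)
  note v = v v8
  have v9: "A $ 9 = 1345051/5040" "B $ 9 = 684877/2520" "A0 $ 9 = 11477929/40320" "B0 $ 9 = 86581/720"
    using rec[of 9] by (simp_all add: v)
  note v = v v9
  have v10: "A $ 10 = 29404649/40320" "B $ 10 = 10377307/13440" "A0 $ 10 = 280563841/362880" "B0 $ 10 = 1714063/5040"
    using rec[of 10] by (simp_all add: v)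
  note v = v v10
  have N: "real n * real (N_m n) = fact n * (A $ n + B $ n)" for n
    using N_m_coeff[OF U, of n] by (simp only: A_def B_def fps_add_nth)
  have "real (N_m 1) = 1" "real (N_m 2) = 1" "real (N_m 3) = 6" "real (N_m 4) = 24"
    "real (N_m 5) = 320" "real (N_m 6) = 3270" "real (N_m 7) = 55482" "real (N_m 8) = 999656"
    "real (N_m 9) = 21718440" "real (N_m 10) = 544829130"
    using N[of 1] N[of 2] N[of 3] N[of 4] N[of 5] N[of 6] N[of 7] N[of 8] N[of 9] N[of 10]
    by (simp_all add: v fact_numeral)
  moreover have "[1..<11] = [1, 2, 3, 4, 5, 6, 7, 8, 9, 10 :: nat]" by (simp add: upt_rec)
  ultimately show ?thesis by simp
qed

theorem theorem4:
  shows "(\<exists>!U :: real fps. fps_nth U 0 = 0 \<and>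
            U = fps_X ^ 2 * fexp (- (fps_X ^ 2 * fexp (2 * U)) + fps_X * fexp U + 3 * U))
       \<and> (\<forall>U :: real fps. fps_nth U 0 = 0 \<and>
            U = fps_X ^ 2 * fexp (- (fps_X ^ 2 * fexp (2 * U)) + fps_X * fexp U + 3 * U) \<longrightarrow>
            F_m = - fps_const (1/2) * (fps_X * fexp U + U) ^ 2
                  + (1 + U * fps_X * fexp U) * (fps_X * fexp U) + U - U ^ 2)
       \<and> map N_m [1..<11] = [1, 1, 6, 24, 320, 3270, 55482, 999656, 21718440, 544829130]"
  using ex1_matching_step_fixpoint F_m_eq N_m_values
  unfolding matching_step_def matching_formula_def by blast

end
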